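(* Let $\mathcal{P}$ be a dynamical pair assignment and let $X$ be a compact metrizable space, with $\mathcal{P}_X\in\mathcal{P}$ the corresponding map. Then the $\mathcal{P}$ rank $\varphi_{\mathcal{P}}(T)=|\mathcal{P}_X(T)|_{\Gamma}$, on $R(\mathcal{P}_X)\subseteq C(X,X)$, is a coanalytic rank.
   Context: A topological dynamical system (TDS) $(X,T)$ is a compact metrizable space $X$ with a continuous map $T\colon X\to X$. A factor map $\varphi\colon (X,T)\to(X_1,T_1)$ between TDSs is a continuous surjection $\varphi\colon X\to X_1$ with $\varphi\circ T=T_1\circ\varphi$. $C(X,X)$ is the set of continuous self-maps of $X$ with the uniform topology; $K(Y)$ is the space of compact subsets of $Y$ with the Vietoris topology (Hausdorff metric). A set $A\subseteq X^2$ is $T\times T$-invariant if $(T\times T)(A)\subseteq A$. $\Delta_X=\{(x,x):x\in X\}$. A dynamical pair assignment $\mathcal{P}$ is a collection of maps $\mathcal{P}_X\colon C(X,X)\to K(X^2)$, one for each compact metrizable space $X$, such that: (1) $\mathcal{P}_X(T)$ is $T\times T$-invariant for every $T\in C(X,X)$; (2) if $\varphi\colon (X,T)\to (X_1,T_1)$ is a factor map and $(x,y)\in\mathcal{P}_X(T)$, then $(\varphi(x),\varphi(y))\in\mathcal{P}_{X_1}(T_1)$; (3) each $\mathcal{P}_X$ is a Borel map. $(X,T)$ is $\mathcal{P}$-realizable if the smallest $T\times T$-invariant closed equivalence relation on $X$ containing $\mathcal{P}_X(T)$ is $X^2$. $R(\mathcal{P}_X)=\{T\in C(X,X): (X,T)\text{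 is }\mathcal{P}\text{-realizable}\}$. For $F\subseteq X^2$ the transitive closure is $F^+=\{(u,v)\in X^2:\exists\, u=u_1,\dots,u_n=v \text{ with }(u_i,u_{i+1})\in F \text{ for all } i<n\}$. For $E\subseteq X^2$ put $\Gamma(E)=\overline{E^+\cup\Delta_X}$, $\Gamma^0(E)=E$, $\Gamma^{\alpha+1}(E)=\Gamma(\Gamma^{\alpha}(E))$, and $\Gamma^{\lambda}(E)=\overline{\bigcup_{\beta<\lambda}\Gamma^{\beta}(E)}$ for limit $\lambda$. $|E|_{\Gamma}$, the $\Gamma$ rank of $E$, is the least ordinal $\alpha$ with $\Gamma^{\alpha}(E)=\Gamma^{\alpha+1}(E)$ (it is a countable ordinal). A subset of a Polish space is analytic if it is the continuous image of a Borel set of a Polish space, and coanalytic if its complement is analytic. Coanalytic rank: let $Y$ be a Polish space and $C\subseteq Y$ a coanalytic subset. A function $\varphi\colon C\to\omega_1$ is a coanalytic rank on $C$ if there are $P,Q\subseteq Y^2$ with $P$ and $Y^2\setminus Q$ analytic such that for all $y\in C$: $\{x\in C:\varphi(x)\le\varphi(y)\}=\{x\in Y:(x,y)\in P\}=\{x\in Y:(x,y)\in Q\}$. Here $Y=C(X,X)$ and $C=R(\mathcal{P}_X)$, which is a coanalytic subset of $C(X,X)$.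
   Formalization: The formal theorem additionally assumes that P_X(T) is symmetric for every T in C(X,X); without this the claim fails, e.g. for P_X(T) = {(x,Tx)} on the cone over [0,1], where the ranks are unbounded on a closed subset of R(P_X). *)

theory Defs
  imports "HOL-Analysis.Analysis" "HOL-Library.Countable_Set_Type"
begin

section \<open>The ordinals below $\omega_1$\<close>

text \<open>
  The elements of \<open>omega1\<close> are the countable ordinals: the type is well-ordered, uncountable, and
  all its proper initial segments are countable (proved below).
\<close>

typedef omega1 = "Field (cardSuc natLeq)"
proof -
  have "infinite (Field (cardSuc natLeq))"
    using cardSuc_finite[OF natLeq_Card_order] by (simp add: Field_natLeq)
  then show ?thesis
    by (metis ex_in_conv finite.emptyI)
qed

lemma Well_order_cardSuc_natLeq: "Well_order (cardSuc natLeq)"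
  using cardSuc_Card_order[OF natLeq_Card_order] card_order_on_well_order_on by blast

instantiation omega1 :: wellorder
begin

definition less_eq_omega1 :: "omega1 \<Rightarrow> omega1 \<Rightarrow> bool"
  where "less_eq_omega1 x y \<longleftrightarrow> (Rep_omega1 x, Rep_omega1 y) \<in> cardSuc natLeq"

definition less_omega1 :: "omega1 \<Rightarrow> omega1 \<Rightarrow> bool"
  where "less_omega1 x y \<longleftrightarrow> x \<le> y \<and> \<not> y \<le> (x::omega1)"

instance
proof
  let ?r = "cardSuc natLeq"
  have props: "refl_on (Field ?r) ?r" "trans ?r" "antisym ?r" "total_on (Field ?r) ?r" "wf (?r - Id)"
    using Well_order_cardSuc_natLeq
    by (auto simp: well_order_on_def linear_order_on_def partial_order_on_def preorder_on_def)
  fix x y z :: omega1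
  show "(x < y) = (x \<le> y \<and> \<not> y \<le> x)"
    by (rule less_omega1_def)
  show "x \<le> x"
    using props(1) Rep_omega1[of x] by (auto simp: less_eq_omega1_def refl_on_def)
  show "x \<le> z" if "x \<le> y" "y \<le> z"
    using props(2) that by (auto simp: less_eq_omega1_def dest: transD)
  show antisym: "x = y" if "x \<le> y" "y \<le> x" for x y :: omega1
    using props(3) that by (auto simp: less_eq_omega1_def Rep_omega1_inject dest: antisymD)
  show "x \<le> y \<or> y \<le> x"
  proof (cases "x = y")
    case True
    then show ?thesis
      using props(1) Rep_omega1[of x] by (auto simp: less_eq_omega1_def refl_on_def)
  next
    case False
    then have "Rep_omega1 x \<noteq> Rep_omega1 y"
      by (simp add: Rep_omega1_inject)
    then show ?thesis
      using props(4) Rep_omega1[of x] Rep_omega1[of y]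
      by (auto simp: less_eq_omega1_def total_on_def)
  qed
  show "P a" if step: "\<And>x. (\<And>y. y < x \<Longrightarrow> P y) \<Longrightarrow> P x" for P :: "omega1 \<Rightarrow> bool" and a
  proof -
    have "wf (inv_image (?r - Id) Rep_omega1)"
      using props(5) by (rule wf_inv_image)
    then show ?thesis
    proof (induction a rule: wf_induct_rule)
      case (less x)
      show ?case
      proof (rule step)
        fix y assume "y < x"
        then have "(y, x) \<in> inv_image (?r - Id) Rep_omega1"
          by (auto simp: less_omega1_def less_eq_omega1_def)
        then show "P y"
          by (rule less.IH)
      qed
    qed
  qed
qed

end

lemma uncountable_omega1: "uncountable (UNIV :: omega1 set)"
proof
  assume "countable (UNIV :: omega1 set)"
  then have "countable (range Rep_omega1)"
    by (rule countable_image)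
  moreover have "range Rep_omega1 = Field (cardSuc natLeq)"
    using type_definition.Rep_range[OF type_definition_omega1] .
  ultimately have "countable (Field (cardSuc natLeq))"
    by simp
  then have "ordLeq3 (card_of (Field (cardSuc natLeq))) natLeq"
    by (simp only: countable_card_le_natLeq)
  then have "ordLeq3 (cardSuc natLeq) natLeq"
    using card_of_Field_ordIso[OF cardSuc_Card_order[OF natLeq_Card_order]]
      ordIso_ordLeq_trans ordIso_symmetric by blast
  then show False
    using cardSuc_greater[OF natLeq_Card_order] not_ordLess_ordLeq by blast
qed

lemma countable_lessThan_omega1: "countable {..<(\<alpha>::omega1)}"
proof -
  let ?r = "cardSuc natLeq"
  have sub: "Rep_omega1 ` {..<\<alpha>} \<subseteq> underS ?r (Rep_omega1 \<alpha>)"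
    by (auto simp: underS_def less_omega1_def less_eq_omega1_def)
  have "ordLess2 (card_of (underS ?r (Rep_omega1 \<alpha>))) ?r"
    by (rule card_of_underS[OF cardSuc_Card_order[OF natLeq_Card_order] Rep_omega1])
  then have "ordLeq3 (card_of (underS ?r (Rep_omega1 \<alpha>))) natLeq"
    using cardSuc_ordLeq_ordLess[OF natLeq_Card_order card_of_Card_order] by blast
  then have "countable (underS ?r (Rep_omega1 \<alpha>))"
    by (simp only: countable_card_le_natLeq)
  then have "countable (Rep_omega1 ` {..<\<alpha>})"
    using sub countable_subset by blast
  then show ?thesis
    using Rep_omega1_inject by (subst (asm) countable_image_inj_eq) (auto simp: inj_on_def)
qed

definition zero_ord :: omega1
  where "zero_ord = (LEAST \<alpha>. True)"

definition suc_ord :: "omega1 \<Rightarrow> omega1"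
  where "suc_ord \<alpha> = (LEAST \<beta>. \<alpha> < \<beta>)"

definition limit_ord :: "omega1 \<Rightarrow> bool"
  where "limit_ord \<alpha> \<longleftrightarrow> \<alpha> \<noteq> zero_ord \<and> (\<forall>\<beta>. \<alpha> \<noteq> suc_ord \<beta>)"

lemma less_suc_ord: "\<alpha> < suc_ord \<alpha>"
proof -
  have "\<exists>\<beta>. \<alpha> < \<beta>"
  proof (rule ccontr)
    assume "\<not> ?thesis"
    then have "UNIV = insert \<alpha> {..<\<alpha>}"
      by (auto simp: not_less le_less)
    then show False
      using uncountable_omega1 countable_lessThan_omega1 by (metis countable_insert)
  qed
  then show ?thesis
    unfolding suc_ord_def by (rule LeastI_ex)
qed

lemma suc_ord_le: "\<alpha> < \<beta> \<Longrightarrow> suc_ord \<alpha> \<le> \<beta>"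
  unfolding suc_ord_def by (rule Least_le)

lemma suc_ord_inject: "suc_ord \<alpha> = suc_ord \<beta> \<longleftrightarrow> \<alpha> = \<beta>"
  by (metis less_suc_ord not_less_iff_gr_or_eq suc_ord_le leD)

lemma suc_ord_neq_zero: "suc_ord \<alpha> \<noteq> zero_ord"
  by (metis Least_le leD less_suc_ord zero_ord_def)

section \<open>The operator $\Gamma$ and the $\Gamma$ rank\<close>

text \<open>
  The library's \<open>E\<^sup>+\<close> requires at least one step; a chain consisting of one point only contributes
  a diagonal pair, and the diagonal is added anyway. Iterating \<open>Gamma\<close> yields the smallest closed
  reflexive and transitive relation containing \<open>E\<close>; this is the smallest closed equivalence
  relation if \<open>E\<close> is symmetric, but not in general.
\<close>

definition Gamma :: "'a topology \<Rightarrow> ('a \<times> 'a) set \<Rightarrow> ('a \<times> 'a) set"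
  where "Gamma X E = (prod_topology X X) closure_of (E\<^sup>+ \<union> Id_on (topspace X))"

function Gamma_iter :: "'a topology \<Rightarrow> ('a \<times> 'a) set \<Rightarrow> omega1 \<Rightarrow> ('a \<times> 'a) set"
  where "Gamma_iter X E \<alpha> =
    (if \<alpha> = zero_ord then E
     else if \<exists>\<beta>. \<alpha> = suc_ord \<beta> then Gamma X (Gamma_iter X E (THE \<beta>. \<alpha> = suc_ord \<beta>))
     else (prod_topology X X) closure_of (\<Union>\<beta>\<in>{..<\<alpha>}. Gamma_iter X E \<beta>))"
  by pat_completeness auto
termination
proof (relation "inv_image {(\<beta>, \<alpha>). \<beta> < \<alpha>} (\<lambda>(X, E, \<alpha>). \<alpha>)")
  show "wf (inv_image {(\<beta>, \<alpha>). \<beta> < \<alpha>} (\<lambda>(X, E, \<alpha>::omega1). \<alpha>))"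
    by (intro wf_inv_image wf)
qed (auto simp: suc_ord_inject less_suc_ord)

declare Gamma_iter.simps [simp del]

lemma Gamma_iter_zero: "Gamma_iter X E zero_ord = E"
  by (subst Gamma_iter.simps) simp

lemma Gamma_iter_suc: "Gamma_iter X E (suc_ord \<alpha>) = Gamma X (Gamma_iter X E \<alpha>)"
  by (subst Gamma_iter.simps) (simp add: suc_ord_inject suc_ord_neq_zero)

lemma Gamma_iter_limit:
  "limit_ord \<alpha> \<Longrightarrow>
    Gamma_iter X E \<alpha> = (prod_topology X X) closure_of (\<Union>\<beta>\<in>{..<\<alpha>}. Gamma_iter X E \<beta>)"
  by (subst Gamma_iter.simps) (auto simp: limit_ord_def)

definition Gamma_rank :: "'a topology \<Rightarrow> ('a \<times> 'a) set \<Rightarrow> omega1"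
  where "Gamma_rank X E = (LEAST \<alpha>. Gamma_iter X E \<alpha> = Gamma_iter X E (suc_ord \<alpha>))"

text \<open>
  Over a compact metrizable space the iteration becomes stationary at a countable stage, so that
  the \<open>LEAST\<close> above, which ranges over countable ordinals only, is the least such ordinal.
\<close>

lemma compact_metrizable_imp_second_countable:
  assumes "compact_space X" "metrizable_space X"
  shows "second_countable X"
proof -
  obtain M d where "Metric_space M d" and X: "X = Metric_space.mtopology M d"
    using assms(2) unfolding metrizable_space_def by blast
  then interpret Metric_space M d
    by simp
  have "mtotally_bounded M"
    using assms(1) compactin_imp_mtotally_bounded[of M] unfolding X compact_space_def by simp
  then have "\<forall>n::nat. \<exists>K. finite K \<and> K \<subseteq> M \<and> M \<subseteq> (\<Union>x\<in>K. mball x (1 / Suc n))"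
    unfolding mtotally_bounded_def by simp
  then obtain K where K: "\<And>n::nat. finite (K n)" "\<And>n. K n \<subseteq> M"
      "\<And>n. M \<subseteq> (\<Union>x\<in>K n. mball x (1 / Suc n))"
    by metis
  define B where "B = (\<Union>n. (\<lambda>x. mball x (1 / Suc n)) ` K n)"
  show ?thesis
    unfolding second_countable_def
  proof (intro exI conjI ballI allI impI)
    show "countable B"
      unfolding B_def using K(1) by (intro countable_UN countable_image) (auto intro: countable_finite)
    show "openin X V" if "V \<in> B" for V
      using that unfolding B_def X by auto
    fix U x assume "openin X U \<and> x \<in> U"
    then obtain r where r: "r > 0" "mball x r \<subseteq> U" and "x \<in> M"
      unfolding X openin_mtopology by blast
    obtain n :: nat where n: "1 / Suc n < r / 2"
      using r(1) by (meson half_gt_zero nat_approx_posE)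
    obtain k where k: "k \<in> K n" "x \<in> mball k (1 / Suc n)"
      using K(3) \<open>x \<in> M\<close> by blast
    have "mball k (1 / Suc n) \<subseteq> mball x r"
    proof
      fix z assume z: "z \<in> mball k (1 / Suc n)"
      have "d x z \<le> d x k + d k z"
        using z k by (intro triangle) auto
      then have "d x z < r"
        using z k n commute[of x k] by auto
      then show "z \<in> mball x r"
        using z \<open>x \<in> M\<close> by auto
    qed
    then have "x \<in> mball k (1 / Suc n) \<and> mball k (1 / Suc n) \<subseteq> U"
      using k r by auto
    moreover have "mball k (1 / Suc n) \<in> B"
      using k unfolding B_def by blast
    ultimately show "\<exists>V\<in>B. x \<in> V \<and> V \<subseteq> U"
      by blast
  qed
qed

lemma Gamma_superset:
  assumes "E \<subseteq> topspace X \<times> topspace X"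
  shows "E \<subseteq> Gamma X E" "Gamma X E \<subseteq> topspace X \<times> topspace X"
proof -
  have "E\<^sup>+ \<union> Id_on (topspace X) \<subseteq> topspace (prod_topology X X)"
    using assms trancl_subset_Sigma[of E "topspace X"] by auto
  then show "E \<subseteq> Gamma X E"
    unfolding Gamma_def using closure_of_subset[of "E\<^sup>+ \<union> Id_on (topspace X)" "prod_topology X X"] by auto
  show "Gamma X E \<subseteq> topspace X \<times> topspace X"
    unfolding Gamma_def using closure_of_subset_topspace[of "prod_topology X X"] by simp
qed

lemma Gamma_iter_subset:
  assumes "E \<subseteq> topspace X \<times> topspace X"
  shows "Gamma_iter X E \<alpha> \<subseteq> topspace X \<times> topspace X"
proof (induction \<alpha> rule: less_induct)
  case (less \<alpha>)
  consider "\<alpha> = zero_ord" | \<beta> where "\<alpha> = suc_ord \<beta>" | "limit_ord \<alpha>"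
    unfolding limit_ord_def by blast
  then show ?case
  proof cases
    case 1
    then show ?thesis using assms by (simp add: Gamma_iter_zero)
  next
    case 2
    then show ?thesis using Gamma_superset(2)[OF less.IH] less_suc_ord by (simp add: Gamma_iter_suc)
  next
    case 3
    then show ?thesis
      using closure_of_subset_topspace[of "prod_topology X X"] by (simp add: Gamma_iter_limit)
  qed
qed

lemma Gamma_iter_mono:
  assumes E: "E \<subseteq> topspace X \<times> topspace X" and "\<alpha> \<le> \<beta>"
  shows "Gamma_iter X E \<alpha> \<subseteq> Gamma_iter X E \<beta>"
  using \<open>\<alpha> \<le> \<beta>\<close>
proof (induction \<beta> rule: less_induct)
  case (less \<beta>)
  show ?case
  proof (cases "\<alpha> = \<beta>")
    case False
    with less.prems have lt: "\<alpha> < \<beta>"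
      by simp
    consider "\<beta> = zero_ord" | \<gamma> where "\<beta> = suc_ord \<gamma>" | "limit_ord \<beta>"
      unfolding limit_ord_def by blast
    then show ?thesis
    proof cases
      case 1
      then show ?thesis using lt by (metis Least_le leD zero_ord_def)
    next
      case 2
      then have "\<alpha> \<le> \<gamma>" "\<gamma> < \<beta>"
        using lt suc_ord_le[of \<gamma> \<alpha>] less_suc_ord[of \<gamma>] by (auto simp: not_le[symmetric])
      then show ?thesis
        using less.IH[of \<gamma>] Gamma_superset(1)[OF Gamma_iter_subset[OF E], of \<gamma>] 2
        by (simp add: Gamma_iter_suc)
    next
      case 3
      have "(\<Union>\<gamma>\<in>{..<\<beta>}. Gamma_iter X E \<gamma>) \<subseteq> topspace (prod_topology X X)"
        using Gamma_iter_subset[OF E] by auto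
      then have "(\<Union>\<gamma>\<in>{..<\<beta>}. Gamma_iter X E \<gamma>) \<subseteq> Gamma_iter X E \<beta>"
        unfolding Gamma_iter_limit[OF 3] by (rule closure_of_subset)
      then show ?thesis
        using lt by blast
    qed
  qed simp
qed

lemma Gamma_rank_exists:
  assumes X: "compact_space X" "metrizable_space X" and E: "closedin (prod_topology X X) E"
  shows "\<exists>\<alpha>. Gamma_iter X E \<alpha> = Gamma_iter X E (suc_ord \<alpha>)"
proof (rule ccontr)
  assume contr: "\<not> ?thesis"
  have sub: "E \<subseteq> topspace X \<times> topspace X"
    using closedin_subset[OF E] by simp
  have closed: "closedin (prod_topology X X) (Gamma_iter X E \<alpha>)" for \<alpha>
    using E by (subst Gamma_iter.simps) (simp add: Gamma_def del: closure_of_Un)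
  have "second_countable (prod_topology X X)"
    using X by (intro compact_metrizable_imp_second_countable)
      (simp_all add: compact_space_prod_topology metrizable_space_prod_topology)
  then obtain B where B: "countable B" and
    base: "\<And>U x. openin (prod_topology X X) U \<Longrightarrow> x \<in> U \<Longrightarrow> \<exists>V\<in>B. x \<in> V \<and> V \<subseteq> U"
    unfolding second_countable_def by metis
  have "\<exists>V\<in>B. V \<inter> Gamma_iter X E \<alpha> = {} \<and> V \<inter> Gamma_iter X E (suc_ord \<alpha>) \<noteq> {}" for \<alpha>
  proof -
    have "Gamma_iter X E \<alpha> \<subseteq> Gamma_iter X E (suc_ord \<alpha>)"
      using Gamma_iter_mono[OF sub] less_suc_ord less_imp_le by blast
    with contr obtain p where p: "p \<in> Gamma_iter X E (suc_ord \<alpha>)" "p \<notin> Gamma_iter X E \<alpha>"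
      by blast
    have "openin (prod_topology X X) (topspace (prod_topology X X) - Gamma_iter X E \<alpha>)"
      using closed by (simp add: closedin_def)
    moreover have "p \<in> topspace (prod_topology X X) - Gamma_iter X E \<alpha>"
      using p Gamma_iter_subset[OF sub] by auto
    ultimately obtain V where "V \<in> B" "p \<in> V" "V \<subseteq> topspace (prod_topology X X) - Gamma_iter X E \<alpha>"
      using base by blast
    then show ?thesis
      using p by blast
  qed
  then obtain V where V: "\<And>\<alpha>. V \<alpha> \<in> B" "\<And>\<alpha>. V \<alpha> \<inter> Gamma_iter X E \<alpha> = {}"
      "\<And>\<alpha>. V \<alpha> \<inter> Gamma_iter X E (suc_ord \<alpha>) \<noteq> {}"
    by metis
  have neq: "V \<alpha> \<noteq> V \<beta>" if "\<alpha> < \<beta>" for \<alpha> \<beta>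
    using V(2)[of \<beta>] V(3)[of \<alpha>] Gamma_iter_mono[OF sub suc_ord_le[OF that]] by blast
  then have "inj V"
    unfolding inj_on_def by (metis linorder_neqE)
  moreover have "countable (range V)"
    using B V(1) by (meson countable_subset image_subsetI)
  ultimately have "countable (UNIV :: omega1 set)"
    using countable_image_inj_eq by blast
  then show False
    using uncountable_omega1 by contradiction
qed

section \<open>Descriptive set theory\<close>

definition borel_of :: "'a topology \<Rightarrow> 'a measure"
  where "borel_of X = sigma (topspace X) {U. openin X U}"

definition Polish_space :: "'a topology \<Rightarrow> bool"
  where "Polish_space X \<longleftrightarrow> completely_metrizable_space X \<and> separable_space X"

text \<open>
  A Polish space embeds topologically into $\mathbb{R}^{\mathbb{N}}$, so all Polish spaces are
  represented, up to homeomorphism, by topologies \<open>Z\<close> whose points have type \<open>nat \<Rightarrow> real\<close>. The topology \<open>Z\<close>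
  is arbitrary; it need not be induced by the product topology.
\<close>

definition analytic_in :: "'a topology \<Rightarrow> 'a set \<Rightarrow> bool"
  where "analytic_in Y A \<longleftrightarrow> A \<subseteq> topspace Y \<and>
    (\<exists>(Z :: (nat \<Rightarrow> real) topology) B f. Polish_space Z \<and> B \<in> sets (borel_of Z) \<and>
       continuous_map (subtopology Z B) Y f \<and> f ` B = A)"

definition coanalytic_in :: "'a topology \<Rightarrow> 'a set \<Rightarrow> bool"
  where "coanalytic_in Y A \<longleftrightarrow> A \<subseteq> topspace Y \<and> analytic_in Y (topspace Y - A)"

definition coanalytic_rank :: "'a topology \<Rightarrow> 'a set \<Rightarrow> ('a \<Rightarrow> omega1) \<Rightarrow> bool"
  where "coanalytic_rank Y C \<phi> \<longleftrightarrow> Polish_space Y \<and> coanalytic_in Y C \<and>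
    (\<exists>P Q. analytic_in (prod_topology Y Y) P \<and> coanalytic_in (prod_topology Y Y) Q \<and>
       (\<forall>y\<in>C. {x \<in> C. \<phi> x \<le> \<phi> y} = {x \<in> topspace Y. (x, y) \<in> P} \<and>
               {x \<in> C. \<phi> x \<le> \<phi> y} = {x \<in> topspace Y. (x, y) \<in> Q}))"

section \<open>Dynamical pair assignments\<close>

text \<open>
  For compact \<open>X\<close> the topology of \<^const>\<open>cfunspace\<close> does not depend on the metric chosen. Elements of
  \<^const>\<open>cfunspace\<close> are extensional, so that each continuous self-map of \<open>X\<close> occurs exactly once.
\<close>

definition uniform_topology :: "'a topology \<Rightarrow> ('a \<Rightarrow> 'a) topology"
  where "uniform_topology X = mtopology_of (cfunspace X (SOME m. mtopology_of m = X))"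

abbreviation C_self :: "'a topology \<Rightarrow> ('a \<Rightarrow> 'a) set"
  where "C_self X \<equiv> topspace (uniform_topology X)"

lemma C_self_eq:
  assumes "compact_space X" "metrizable_space X"
  shows "C_self X = {T. continuous_map X X T \<and> T \<in> extensional (topspace X)}"
proof -
  define m where "m = (SOME m. mtopology_of m = X)"
  obtain M d where Md: "Metric_space M d" and "X = Metric_space.mtopology M d"
    using assms(2) unfolding metrizable_space_def by blast
  then have "mtopology_of (metric (M, d)) = X"
    by (simp add: mtopology_of_def Metric_space.mspace_metric Metric_space.mdist_metric)
  then have m: "mtopology_of m = X"
    unfolding m_def by (rule someI)
  interpret Metric_space "mspace m" "mdist m"
    by (rule Metric_space_mspace_mdist)
  have top: "topspace X = mspace m"
    using m by auto
  have "mbounded (T ` topspace X)" if "continuous_map X X T" for T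
  proof (rule compactin_imp_mbounded)
    have "compactin X (T ` topspace X)"
      using image_compactin[OF _ that] assms(1) by (simp add: compact_space_def)
    then show "compactin mtopology (T ` topspace X)"
      using m by (simp add: mtopology_of_def)
  qed
  then show ?thesis
    unfolding uniform_topology_def m_def[symmetric]
    using m top by (auto simp: continuous_map_def)
qed

text \<open>\<open>Vietoris Y\<close> is the space of compact subsets of \<open>Y\<close>, including the empty one.\<close>

definition Vietoris :: "'a topology \<Rightarrow> 'a set topology"
  where "Vietoris Y = topology_generated_by
    ({{K. compactin Y K \<and> K \<subseteq> U} | U. openin Y U} \<union>
     {{K. compactin Y K \<and> K \<inter> U \<noteq> {}} | U. openin Y U})"

lemma topspace_Vietoris: "topspace (Vietoris Y) = {K. compactin Y K}"
proof
  show "topspace (Vietoris Y) \<subseteq> {K. compactin Y K}"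
    unfolding Vietoris_def topology_generated_by_topspace by auto
  have "{K. compactin Y K \<and> K \<subseteq> topspace Y} \<in> {{K. compactin Y K \<and> K \<subseteq> U} | U. openin Y U}"
    by (intro CollectI exI[of _ "topspace Y"]) simp
  then have "{K. compactin Y K \<and> K \<subseteq> topspace Y} \<subseteq> topspace (Vietoris Y)"
    unfolding Vietoris_def topology_generated_by_topspace by (intro Union_upper UnI1)
  then show "{K. compactin Y K} \<subseteq> topspace (Vietoris Y)"
    by (auto dest: compactin_subset_topspace)
qed

definition invariant_pairs :: "('a \<Rightarrow> 'a) \<Rightarrow> ('a \<times> 'a) set \<Rightarrow> bool"
  where "invariant_pairs T A \<longleftrightarrow> map_prod T T ` A \<subseteq> A"

definition factor_map ::
    "'a topology \<Rightarrow> ('a \<Rightarrow> 'a) \<Rightarrow> 'b topology \<Rightarrow> ('b \<Rightarrow> 'b) \<Rightarrow> ('a \<Rightarrow> 'b) \<Rightarrow> bool"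
  where "factor_map X T X1 T1 \<phi> \<longleftrightarrow> continuous_map X X1 \<phi> \<and> \<phi> ` topspace X = topspace X1 \<and>
    (\<forall>x\<in>topspace X. \<phi> (T x) = T1 (\<phi> x))"

text \<open>
  HOL has no collection of all compact metrizable spaces; the spaces range over all topologies whose
  points belong to an arbitrary type \<open>'a\<close>. Every compact metrizable space occurs up to
  homeomorphism if \<open>'a\<close> has at least the cardinality of the continuum. An assignment on a larger
  collection of spaces restricts to one in the sense of this definition.
\<close>

definition dynamical_pair_assignment ::
    "('a topology \<Rightarrow> ('a \<Rightarrow> 'a) \<Rightarrow> ('a \<times> 'a) set) \<Rightarrow> bool"
  where "dynamical_pair_assignment P \<longleftrightarrow>
    (\<forall>X. compact_space X \<and> metrizable_space X \<longrightarrow>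
       (\<forall>T\<in>C_self X. compactin (prod_topology X X) (P X T)) \<and>
       (\<forall>T\<in>C_self X. invariant_pairs T (P X T)) \<and>
       P X \<in> borel_of (uniform_topology X) \<rightarrow>\<^sub>M borel_of (Vietoris (prod_topology X X))) \<and>
    (\<forall>X X1 T T1 \<phi>. compact_space X \<and> metrizable_space X \<and> compact_space X1 \<and> metrizable_space X1 \<and>
       T \<in> C_self X \<and> T1 \<in> C_self X1 \<and> factor_map X T X1 T1 \<phi> \<longrightarrow>
       (\<forall>(x, y)\<in>P X T. (\<phi> x, \<phi> y) \<in> P X1 T1))"

text \<open>
  The intersection is itself an invariant closed equivalence relation, and the family is nonempty
  since it contains the full relation if \<open>T\<close> maps \<open>X\<close> to itself.
\<close>

definition ICER_generated :: "'a topology \<Rightarrow> ('a \<Rightarrow> 'a) \<Rightarrow> ('a \<times> 'a) set \<Rightarrow> ('a \<times> 'a) set"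
  where "ICER_generated X T A =
    \<Inter>{R. equiv (topspace X) R \<and> closedin (prod_topology X X) R \<and> invariant_pairs T R \<and> A \<subseteq> R}"

definition realizable ::
    "('a topology \<Rightarrow> ('a \<Rightarrow> 'a) \<Rightarrow> ('a \<times> 'a) set) \<Rightarrow> 'a topology \<Rightarrow> ('a \<Rightarrow> 'a) \<Rightarrow> bool"
  where "realizable P X T \<longleftrightarrow> ICER_generated X T (P X T) = topspace X \<times> topspace X"

definition realizable_maps ::
    "('a topology \<Rightarrow> ('a \<Rightarrow> 'a) \<Rightarrow> ('a \<times> 'a) set) \<Rightarrow> 'a topology \<Rightarrow> ('a \<Rightarrow> 'a) set"
  where "realizable_maps P X = {T \<in> C_self X. realizable P X T}"

definition pair_rank ::
    "('a topology \<Rightarrow> ('a \<Rightarrow> 'a) \<Rightarrow> ('a \<times> 'a) set) \<Rightarrow> 'a topology \<Rightarrow> ('a \<Rightarrow> 'a) \<Rightarrow> omega1"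
  where "pair_rank P X T = Gamma_rank X (P X T)"

end

theory Submission
  imports Defs
begin

text \<open>
  Fix a countable base $V_0, V_1, \dots$ of $X^2$ and code a closed relation by the set of all \<open>j\<close> such
  that \<open>V j\<close> is nonempty and misses it. For the sets $S_\alpha$ coding the iterates of \<open>\<Gamma>\<close> this gives
  $S_\alpha = S_0 \cap \bigcap_{\beta<\alpha} D(S_\beta)$ with a monotone Borel operator \<open>D\<close> on sets of
  natural numbers; \<open>T\<close> is realizable iff some $S_\alpha$ is empty, and the rank is the least such \<open>\<alpha>\<close>.

  Ranks of two such iterations are compared by certificates: a relation \<open>R\<close> on the natural numbers
  and families of sets that lie below, respectively above, the stages of the iterations along \<open>R\<close>. An
  infinite \<open>R\<close>-descending sequence produces a nonempty set \<open>A\<close> with $A \subseteq S_0 \cap D(A)$, which is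
  impossible for an iteration that reaches the empty set. So \<open>R\<close> need not be required to be
  well-founded, the conditions on a certificate are Borel, and their projections are analytic.
\<close>

subsection \<open>Polish spaces and analytic sets\<close>

lemma sets_borel_of: "sets (borel_of X) = sigma_sets (topspace X) {U. openin X U}"
  unfolding borel_of_def by (auto dest: openin_subset intro!: sets_measure_of)

lemma space_borel_of [simp]: "space (borel_of X) = topspace X"
  unfolding borel_of_def by (auto dest: openin_subset intro!: space_measure_of)

lemma openin_imp_borel_of: "openin X U \<Longrightarrow> U \<in> sets (borel_of X)"
  by (simp add: sets_borel_of)

lemma borel_of_euclidean: "borel_of euclidean = borel"
  by (simp add: borel_of_def borel_def)

lemma continuous_map_borel_of_measurable:
  assumes "continuous_map X Y f"
  shows "f \<in> borel_of X \<rightarrow>\<^sub>M borel_of Y"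
  unfolding borel_of_def[of Y]
proof (rule measurable_measure_of)
  show "{U. openin Y U} \<subseteq> Pow (topspace Y)"
    by (auto dest: openin_subset)
  show "f \<in> space (borel_of X) \<rightarrow> topspace Y"
    using assms by (simp add: continuous_map_def)
  fix U assume "U \<in> {U. openin Y U}"
  then have "openin X {x \<in> topspace X. f x \<in> U}"
    using assms by (simp add: continuous_map_def)
  moreover have "{x \<in> topspace X. f x \<in> U} = f -` U \<inter> space (borel_of X)"
    by auto
  ultimately show "f -` U \<inter> space (borel_of X) \<in> sets (borel_of X)"
    by (metis openin_imp_borel_of)
qed

section \<open>Polish spaces and their transport to \<open>nat \<Rightarrow> real\<close>\<close>

lemma separable_space_prod_topology:
  assumes "separable_space X" "separable_space Y"
  shows "separable_space (prod_topology X Y)"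
proof -
  obtain A B where "countable A" "A \<subseteq> topspace X" "X closure_of A = topspace X"
    "countable B" "B \<subseteq> topspace Y" "Y closure_of B = topspace Y"
    using assms unfolding separable_space_def by metis
  then show ?thesis
    unfolding separable_space_def
    by (intro exI[of _ "A \<times> B"]) (auto simp: closure_of_Times)
qed

lemma Polish_space_prod_topology:
  assumes "Polish_space X" "Polish_space Y"
  shows "Polish_space (prod_topology X Y)"
  using assms unfolding Polish_space_def
  by (simp add: completely_metrizable_space_prod_topology separable_space_prod_topology)

lemma Polish_space_euclidean: "Polish_space (euclidean :: 'a::polish_space topology)"
proof -
  obtain D :: "'a set" where D: "countable D" "\<And>U. open U \<Longrightarrow> U \<noteq> {} \<Longrightarrow> \<exists>d\<in>D. d \<in> U"
    using countable_dense_setE by blast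
  have "separable_space (euclidean :: 'a topology)"
    unfolding separable_space_def
  proof (intro exI conjI)
    show "euclidean closure_of D = topspace euclidean"
      unfolding closure_of_def using D(2) by auto
  qed (use D in auto)
  then show ?thesis
    unfolding Polish_space_def by (simp add: completely_metrizable_space_euclidean)
qed

text \<open>A point is determined by its distances to a countable dense set: a dense point very near
  \<open>x\<close> would have to be equally near \<open>y\<close>.\<close>

lemma inj_on_nat_to_real_if_separable:
  assumes "metrizable_space W" "separable_space W"
  obtains g :: "'a \<Rightarrow> nat \<Rightarrow> real" where "inj_on g (topspace W)"
proof -
  obtain M d where "Metric_space M d" and W: "W = Metric_space.mtopology M d"
    using assms(1) unfolding metrizable_space_def by blast
  then interpret Metric_space M d
    by simp
  obtain C where C: "countable C" "C \<subseteq> M" "W closure_of C = topspace W"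
    using assms(2) unfolding separable_space_def W by auto
  have "inj_on (\<lambda>x n. d x (from_nat_into C n)) (topspace W)"
  proof (rule inj_onI)
    fix x y assume xy: "x \<in> topspace W" "y \<in> topspace W"
      and eq: "(\<lambda>n. d x (from_nat_into C n)) = (\<lambda>n. d y (from_nat_into C n))"
    then have M: "x \<in> M" "y \<in> M"
      by (auto simp: W)
    have eqC: "d x q = d y q" if "q \<in> C" for q
      using fun_cong[OF eq, of "to_nat_on C q"] that C(1) by simp
    show "x = y"
    proof (rule ccontr)
      assume "x \<noteq> y"
      then have pos: "d x y / 2 > 0"
        using M by simp
      have "x \<in> W closure_of C"
        using xy C(3) by simp
      then obtain q where q: "q \<in> C" "q \<in> mball x (d x y / 2)"
        unfolding W metric_closure_of using pos by blast
      have "d x y \<le> d x q + d y q"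
        using q M C(2) triangle[of x q y] commute[of q y] by auto
      then show False
        using q eqC[OF q(1)] by auto
    qed
  qed
  then show thesis
    by (rule that)
qed

text \<open>\<open>analytic_in\<close> admits only Polish spaces on the type
  \<open>nat \<Rightarrow> real\<close>. The injection \<open>g\<close> moves \<open>W\<close>
  there: \<open>Z\<close> is the pullback of \<open>W\<close> along the inverse \<open>h\<close>,
  which makes \<open>g\<close> a homeomorphism.\<close>

lemma analytic_in_image:
  fixes W :: "'w topology"
  assumes W: "Polish_space W" and B: "B \<in> sets (borel_of W)"
    and f: "continuous_map (subtopology W B) Y f"
  shows "analytic_in Y (f ` B)"
proof -
  have BW: "B \<subseteq> topspace W"
    using sets.sets_into_space[OF B] by simp
  have "metrizable_space W"
    using W by (simp add: Polish_space_def completely_metrizable_imp_metrizable_space)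
  then obtain g :: "'w \<Rightarrow> nat \<Rightarrow> real" where g: "inj_on g (topspace W)"
    using W inj_on_nat_to_real_if_separable unfolding Polish_space_def by blast
  define h where "h = inv_into (topspace W) g"
  define Z where "Z = pullback_topology (g ` topspace W) h W"
  have hg: "h (g x) = x" if "x \<in> topspace W" for x
    using that g by (simp add: h_def)
  have topZ: "topspace Z = g ` topspace W"
    unfolding Z_def topspace_pullback_topology using hg by auto
  have h: "continuous_map Z W h"
    using continuous_map_pullback[of W W id "g ` topspace W" h] unfolding Z_def by simp
  have gZ: "continuous_map W Z g"
    unfolding Z_def
  proof (rule continuous_map_pullback')
    show "continuous_map W W (h \<circ> g)"
      using hg by (simp add: continuous_map_eq[OF continuous_map_id])
    show "topspace W \<subseteq> g -` (g ` topspace W)"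
      by auto
  qed
  have "homeomorphic_maps W Z g h"
    unfolding homeomorphic_maps_def using h gZ hg topZ by auto
  then have "W homeomorphic_space Z"
    unfolding homeomorphic_space_def by blast
  then have Z: "Polish_space Z"
    using W unfolding Polish_space_def
    using homeomorphic_completely_metrizable_space homeomorphic_separable_space by blast
  have gB: "g ` B = h -` B \<inter> space (borel_of Z)"
    using BW hg by (auto simp: topZ image_iff)
  have "g ` B \<in> sets (borel_of Z)"
    unfolding gB using continuous_map_borel_of_measurable[OF h] B by (rule measurable_sets)
  moreover have "continuous_map (subtopology Z (g ` B)) Y (f \<circ> h)"
  proof (rule continuous_map_compose[OF _ f])
    show "continuous_map (subtopology Z (g ` B)) (subtopology W B) h"
      using h BW hg by (auto simp: continuous_map_in_subtopology continuous_map_from_subtopology)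
  qed
  moreover have "(f \<circ> h) ` g ` B = f ` B"
    using BW hg by (force simp: image_iff)
  moreover have "f ` B \<subseteq> topspace Y"
    using f BW by (auto simp: continuous_map_def Pi_iff)
  ultimately show ?thesis
    unfolding analytic_in_def using Z by blast
qed

lemma analytic_in_projection:
  fixes pr :: "'y \<Rightarrow> 'c::polish_space \<Rightarrow> bool"
  assumes Y: "Polish_space Y"
    and pr: "Measurable.pred (borel_of (prod_topology Y (euclidean :: 'c topology))) (\<lambda>(y, c). pr y c)"
  shows "analytic_in Y {y \<in> topspace Y. \<exists>c. pr y c}"
proof -
  let ?W = "prod_topology Y (euclidean :: 'c topology)"
  let ?B = "{w \<in> space (borel_of ?W). case w of (y, c) \<Rightarrow> pr y c}"
  have "?B \<in> sets (borel_of ?W)"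
    using pr by (rule predE)
  moreover have "Polish_space ?W"
    using Y Polish_space_euclidean by (rule Polish_space_prod_topology)
  moreover have "continuous_map (subtopology ?W ?B) Y fst"
    by (intro continuous_map_from_subtopology continuous_map_fst)
  ultimately have "analytic_in Y (fst ` ?B)"
    using analytic_in_image by blast
  moreover have "fst ` ?B = {y \<in> topspace Y. \<exists>c. pr y c}"
    by force
  ultimately show ?thesis
    by simp
qed

text \<open>Completeness comes from that of compact \<open>X\<close>. For separability, a map is
  described up to a small error by finitely many pairs of basic sets, the first mapped into the
  second; one chosen map per satisfiable description yields a countable dense set.\<close>

lemma Polish_space_uniform_topology:
  assumes "compact_space X" "metrizable_space X"
  shows "Polish_space (uniform_topology X)"
proof -
  define m where "m = (SOME m. mtopology_of m = X)"
  obtain M d where Md: "Metric_space M d" and "X = Metric_space.mtopology M d"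
    using assms(2) unfolding metrizable_space_def by blast
  then have "mtopology_of (metric (M, d)) = X"
    by (simp add: mtopology_of_def Metric_space.mspace_metric Metric_space.mdist_metric)
  then have m: "mtopology_of m = X"
    unfolding m_def by (rule someI)
  interpret Metric_space "mspace m" "mdist m"
    by (rule Metric_space_mspace_mdist)
  have mX: "mtopology = X"
    using m by (simp add: mtopology_of_def)
  then have top: "topspace X = mspace m"
    by auto
  let ?C = "cfunspace X m"
  interpret C: Metric_space "mspace ?C" "mdist ?C"
    by (rule Metric_space_mspace_mdist)
  have U: "uniform_topology X = C.mtopology"
    unfolding uniform_topology_def m_def[symmetric] by (simp add: mtopology_of_def)
  have "mcomplete"
    using assms(1) mX compact_space_imp_mcomplete by blast
  then have "C.mcomplete"
    using mcomplete_cfunspace[of X] by (simp add: mcomplete_of_def Self_def)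
  then have complete: "completely_metrizable_space (uniform_topology X)"
    unfolding U by (rule C.completely_metrizable_space_mtopology)
  obtain B where B: "countable B" and openB: "\<And>V. V \<in> B \<Longrightarrow> openin X V" and
    base: "\<And>U x. openin X U \<Longrightarrow> x \<in> U \<Longrightarrow> \<exists>V\<in>B. x \<in> V \<and> V \<subseteq> U"
    using compact_metrizable_imp_second_countable[OF assms] unfolding second_countable_def by metis
  define small where "small n = {V \<in> B. \<exists>p \<in> mspace m. V \<subseteq> mball p (1 / Suc n)}" for n
  define adm where "adm n S f \<longleftrightarrow> f \<in> mspace ?C \<and> topspace X \<subseteq> \<Union> (fst ` S) \<and>
    (\<forall>(V, W)\<in>S. f ` V \<subseteq> W)" for n :: nat and S :: "('a set \<times> 'a set) set" and f
  have small_dist: "mdist m x y \<le> 2 / Suc n" 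
    if V: "V \<in> small n" and "x \<in> V" "y \<in> V" for V n x y
  proof -
    obtain p where "p \<in> mspace m" "V \<subseteq> mball p (1 / Suc n)"
      using V unfolding small_def by blast
    then have "x \<in> mball p (1 / Suc n)" "y \<in> mball p (1 / Suc n)"
      using that by auto
    then show ?thesis
      using triangle[of x p y] by (auto simp: commute)
  qed
  define I where "I = (SIGMA n:UNIV. {S. finite S \<and> S \<subseteq> B \<times> small n \<and> Ex (adm n S)})"
  define r where "r = (\<lambda>(n, S). SOME f. adm n S f)"
  have r: "adm n S (r (n, S))" if "(n, S) \<in> I" for n S
    using that unfolding r_def I_def by (auto simp: some_eq_ex[symmetric])
  have "countable I"
  proof -
    have "countable {S. finite S \<and> S \<subseteq> B \<times> small n}" for n
      using B unfolding small_def by (intro countable_Collect_finite_subset countable_SIGMA) auto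
    then show ?thesis
      unfolding I_def 
      by (intro countable_SIGMA countableI_type) (rule countable_subset[rotated], assumption, auto)
  qed
  then have "countable (r ` I)"
    by simp
  moreover have sub: "r ` I \<subseteq> mspace ?C"
    using r unfolding adm_def by (auto simp del: mspace_cfunspace)
  moreover have "\<exists>g\<in>r ` I. g \<in> C.mball f e" if f: "f \<in> mspace ?C" and e: "e > 0" for f e
  proof -
    obtain n where n: "1 / Suc n < e / 2"
      using e by (meson half_gt_zero nat_approx_posE)
    have fc: "continuous_map X X f"
      using f m by simp
    have "\<exists>V\<in>B. \<exists>W\<in>small n. x \<in> V \<and> f ` V \<subseteq> W" if x: "x \<in> topspace X" for x
    proof -
      have fx: "f x \<in> mspace m"
        using fc x top by (auto simp: continuous_map_def)
      have "openin X (mball (f x) (1 / Suc n))"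
        using mX openin_mball by blast
      moreover have "f x \<in> mball (f x) (1 / Suc n)"
        using fx by simp
      ultimately obtain W where W: "W \<in> B" "f x \<in> W" "W \<subseteq> mball (f x) (1 / Suc n)"
        using base by blast
      then have "W \<in> small n"
        using fx unfolding small_def by blast
      moreover have "openin X {y \<in> topspace X. f y \<in> W}"
        using fc openB[OF W(1)] by (simp add: continuous_map_def)
      then obtain V where "V \<in> B" "x \<in> V" "V \<subseteq> {y \<in> topspace X. f y \<in> W}"
        using base x W(2) by blast
      ultimately show ?thesis
        by blast
    qed
    then obtain V W where VW: "\<And>x. x \<in> topspace X \<Longrightarrow> V x \<in> B \<and> W x \<in> small n \<and> x \<in> V x \<and> f ` V x \<subseteq> W x"
      by metis
    have "compactin X (topspace X)"
      using assms(1) by (simp add: compact_space_def)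
    moreover have "\<forall>U\<in>V ` topspace X. openin X U" "topspace X \<subseteq> \<Union>(V ` topspace X)"
      using VW openB by auto
    ultimately obtain F where F: "finite F" "F \<subseteq> V ` topspace X" "topspace X \<subseteq> \<Union>F"
      unfolding compactin_def by meson
    then obtain A where A: "finite A" "A \<subseteq> topspace X" "F = V ` A"
      by (metis finite_subset_image)
    define S where "S = (\<lambda>x. (V x, W x)) ` A"
    have adm: "adm n S f"
      unfolding adm_def
    proof (intro conjI)
      show "topspace X \<subseteq> \<Union> (fst ` S)"
        using F(3) A(3) by (simp add: S_def image_image)
      show "\<forall>(V, W)\<in>S. f ` V \<subseteq> W"
        using A(2) VW unfolding S_def by blast
    qed (rule f)
    have nS: "(n, S) \<in> I"
      unfolding I_def
    proof (intro SigmaI CollectI conjI exI)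
      show "finite S"
        using A(1) by (simp add: S_def)
      show "S \<subseteq> B \<times> small n"
        using A(2) VW unfolding S_def by blast
    qed (auto intro: adm)
    define g where "g = r (n, S)"
    have g: "adm n S g"
      unfolding g_def using r[OF nS] .
    have "mdist ?C f g \<le> 2 / Suc n"
    proof (rule mdist_cfunspace_le)
      fix x assume "x \<in> topspace X"
      then obtain V W where "(V, W) \<in> S" "x \<in> V"
        using adm unfolding adm_def by force
      moreover from this have W: "W \<in> small n"
        using nS unfolding I_def by blast
      moreover have "h ` V \<subseteq> W" if "adm n S h" for h
        using that \<open>(V, W) \<in> S\<close> unfolding adm_def by blast
      ultimately have "f x \<in> W" "g x \<in> W"
        using adm g by blast+
      with W show "mdist m (f x) (g x) \<le> 2 / Suc n"
        by (rule small_dist)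
    qed simp
    also have "2 / Suc n = 2 * (1 / Suc n)"
      by simp
    finally have "mdist ?C f g < e"
      using n by linarith
    then show ?thesis
      using nS f g by (auto simp: g_def adm_def simp del: mspace_cfunspace)
  qed
  then have "C.mtopology closure_of (r ` I) = topspace C.mtopology"
    unfolding C.metric_closure_of C.topspace_mtopology using sub by blast
  ultimately have "separable_space (uniform_topology X)"
    unfolding separable_space_def U by (metis C.topspace_mtopology)
  with complete show ?thesis
    unfolding Polish_space_def by blast
qed

text \<open>Countably many countable initial segments cannot exhaust \<open>omega1\<close>, so a
  strict bound exists. The least one serves in \<open>common_stage\<close> as the stage of an index,
  given those of its predecessors.\<close>

lemma countable_omega1_least_upper_bound:
  fixes A :: "omega1 set"
  assumes "countable A"
  shows "\<exists>\<alpha>. (\<forall>a\<in>A. a < \<alpha>) \<and> (\<forall>\<beta><\<alpha>. \<exists>a\<in>A. \<beta> \<le> a)"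
proof -
  have "\<exists>\<alpha>. \<forall>a\<in>A. a < \<alpha>"
  proof (rule ccontr)
    assume "\<not> ?thesis"
    then have "UNIV = (\<Union>a\<in>A. insert a {..<a})"
      by (fastforce simp: not_less le_less)
    moreover have "countable (\<Union>a\<in>A. insert a {..<a})"
      using assms countable_lessThan_omega1 by (intro countable_UN) auto
    ultimately show False
      using uncountable_omega1 by simp
  qed
  then have "\<forall>a\<in>A. a < (LEAST \<alpha>. \<forall>a\<in>A. a < \<alpha>)"
    by (rule LeastI_ex)
  moreover have "\<exists>a\<in>A. \<beta> \<le> a" if "\<beta> < (LEAST \<alpha>. \<forall>a\<in>A. a < \<alpha>)" for \<beta>
    using not_less_Least[OF that] by (auto simp: not_less)
  ultimately show ?thesis
    by blast
qed

section \<open>Coding sets of natural numbers by real sequences\<close>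

lemma borel_measurable_apply:
  "(\<lambda>c :: 'i \<Rightarrow> 'b::topological_space. c i) \<in> borel \<rightarrow>\<^sub>M borel"
  by (intro borel_measurable_continuous_onI continuous_on_product_coordinates)

text \<open>Signs are used because \<open>c i > 0\<close> is an open condition on \<open>c\<close>,
  on which the closedness of \<open>chain_codes\<close> rests.\<close>

abbreviation bits :: "(nat \<Rightarrow> real) \<Rightarrow> nat set"
  where "bits c \<equiv> {i. c i > 0}"

lemma bits_indicator [simp]: "bits (indicator A) = A"
  by (auto simp: indicator_def split: if_splits)

subsection \<open>Decreasing Borel iterations on sets of natural numbers\<close>

text \<open>The single equation \<open>S_eq\<close> covers zero, successor and limit stages at once;
  at zero the intersection is over the empty family. Only \<open>start\<close> depends on the point
  \<open>T\<close>, the operator \<open>D\<close> does not.\<close>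

locale borel_iteration =
  fixes Y :: "'y topology" and start :: "'y \<Rightarrow> nat set" and D :: "nat set \<Rightarrow> nat set"
    and S :: "'y \<Rightarrow> omega1 \<Rightarrow> nat set"
  assumes Polish: "Polish_space Y"
    and mono_D: "mono D"
    and measurable_D: "\<And>j. Measurable.pred borel (\<lambda>c. j \<in> D (bits c))"
    and measurable_start: "\<And>j. Measurable.pred (borel_of Y) (\<lambda>T. j \<in> start T)"
    and S_eq: "\<And>T \<alpha>. T \<in> topspace Y \<Longrightarrow> S T \<alpha> = start T \<inter> (\<Inter>\<beta>\<in>{..<\<alpha>}. D (S T \<beta>))"
begin

definition terminating :: "'y set"
  where "terminating = {T \<in> topspace Y. \<exists>\<alpha>. S T \<alpha> = {}}"

definition lifetime :: "'y \<Rightarrow> omega1"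
  where "lifetime T = (LEAST \<alpha>. S T \<alpha> = {})"

text \<open>\<open>above\<close> and \<open>below\<close> describe super- and subsolutions of the
  recursion \<open>S_eq\<close>, with indices in place of ordinals and \<open>R\<close> in place of
  their order. Nonemptiness in \<open>below\<close> records that the iteration is still alive at
  every index.\<close>

definition above :: "(nat \<Rightarrow> nat \<Rightarrow> bool) \<Rightarrow> (nat \<Rightarrow> nat set) \<Rightarrow> 'y \<Rightarrow> bool"
  where "above R \<tau> T \<longleftrightarrow> (\<forall>n. start T \<inter> (\<Inter>m\<in>{m. R m n}. D (\<tau> m)) \<subseteq> \<tau> n)"

definition below :: "(nat \<Rightarrow> nat \<Rightarrow> bool) \<Rightarrow> (nat \<Rightarrow> nat set) \<Rightarrow> 'y \<Rightarrow> bool"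
  where "below R \<sigma> T \<longleftrightarrow> (\<forall>n. \<sigma> n \<noteq> {} \<and> \<sigma> n \<subseteq> start T \<inter> (\<Inter>m\<in>{m. R m n}. D (\<sigma> m)))"

section \<open>Stages, lifetimes and certificates\<close>

lemma S_antimono: "T \<in> topspace Y \<Longrightarrow> \<alpha> \<le> \<beta> \<Longrightarrow> S T \<beta> \<subseteq> S T \<alpha>"
  by (subst (1 2) S_eq) auto

lemma S_lifetime: "T \<in> terminating \<Longrightarrow> S T (lifetime T) = {}"
  unfolding terminating_def lifetime_def using LeastI_ex[of "\<lambda>\<alpha>. S T \<alpha> = {}"] by blast

lemma lifetime_le: "S T \<alpha> = {} \<Longrightarrow> lifetime T \<le> \<alpha>"
  unfolding lifetime_def by (rule Least_le)

lemma S_eq_empty_iff: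
  assumes "T \<in> topspace Y"
  shows "S T \<alpha> = {} \<longleftrightarrow> T \<in> terminating \<and> lifetime T \<le> \<alpha>"
proof
  assume "S T \<alpha> = {}"
  then show "T \<in> terminating \<and> lifetime T \<le> \<alpha>"
    using assms lifetime_le by (auto simp: terminating_def)
next
  assume "T \<in> terminating \<and> lifetime T \<le> \<alpha>"
  then show "S T \<alpha> = {}"
    using S_antimono[OF assms] S_lifetime by blast
qed

text \<open>Since \<open>D\<close> is monotone, such a set \<open>A\<close> survives every stage;
  conversely a stage contained in its successor is such a set. This trades a quantifier over
  ordinals for one over sets of naturals.\<close>

lemma not_terminating_iff:
  assumes T: "T \<in> topspace Y"
  shows "T \<notin> terminating \<longleftrightarrow> (\<exists>A. A \<noteq> {} \<and> A \<subseteq> start T \<and> A \<subseteq> D A)"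
proof
  assume "\<exists>A. A \<noteq> {} \<and> A \<subseteq> start T \<and> A \<subseteq> D A"
  then obtain A where A: "A \<noteq> {}" "A \<subseteq> start T" "A \<subseteq> D A"
    by blast
  have "A \<subseteq> S T \<alpha>" for \<alpha>
  proof (induction \<alpha> rule: less_induct)
    case (less \<alpha>)
    then have "A \<subseteq> D (S T \<beta>)" if "\<beta> < \<alpha>" for \<beta>
      using that A(3) monoD[OF mono_D] by blast
    then show ?case
      using A(2) by (subst S_eq[OF T]) blast
  qed
  then show "T \<notin> terminating"
    using A(1) by (auto simp: terminating_def)
next
  assume "T \<notin> terminating"
  then have nonempty: "S T \<alpha> \<noteq> {}" for \<alpha>
    using T by (auto simp: terminating_def)
  \<comment> \<open>If every stage lost an element, picking one lost element per stage would inject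
    \<open>omega1\<close> into the naturals.\<close>
  have "\<exists>\<alpha>. S T \<alpha> \<subseteq> S T (suc_ord \<alpha>)"
  proof (rule ccontr)
    assume "\<not> ?thesis"
    then have "\<forall>\<alpha>. \<exists>j. j \<in> S T \<alpha> \<and> j \<notin> S T (suc_ord \<alpha>)"
      by blast
    then obtain j where j: "\<And>\<alpha>. j \<alpha> \<in> S T \<alpha>" "\<And>\<alpha>. j \<alpha> \<notin> S T (suc_ord \<alpha>)"
      by metis
    have "j \<alpha> \<noteq> j \<beta>" if "\<alpha> < \<beta>" for \<alpha> \<beta>
      using j(1)[of \<beta>] j(2)[of \<alpha>] S_antimono[OF T suc_ord_le[OF that]] by auto
    then have "inj j"
      unfolding inj_on_def by (metis linorder_neqE)
    then show False
      using uncountable_omega1 countableI by blast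
  qed
  then obtain \<alpha> where "S T \<alpha> \<subseteq> S T (suc_ord \<alpha>)"
    by blast
  then have "S T \<alpha> \<subseteq> start T \<and> S T \<alpha> \<subseteq> D (S T \<alpha>)"
    using S_eq[OF T, of "suc_ord \<alpha>"] less_suc_ord[of \<alpha>] by auto
  then show "\<exists>A. A \<noteq> {} \<and> A \<subseteq> start T \<and> A \<subseteq> D A"
    using nonempty by blast
qed

text \<open>Along an infinite descending sequence of \<open>R\<close> the union of the sets \<open>\<sigma> n\<close> is contained in its
  own image under \<open>D\<close>.\<close>

lemma below_imp_wfp:
  assumes "below R \<sigma> T" "T \<in> terminating"
  shows "wfp R"
proof (rule ccontr)
  assume "\<not> wfp R"
  then obtain f where f: "\<And>i. R (f (Suc i)) (f i)"
    unfolding wfp_def wf_iff_no_infinite_down_chain by auto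
  define A where "A = (\<Union>i. \<sigma> (f i))"
  have "\<sigma> (f i) \<subseteq> D A" for i
  proof -
    have "\<sigma> (f i) \<subseteq> D (\<sigma> (f (Suc i)))"
      using assms(1) f unfolding below_def by blast
    also have "\<dots> \<subseteq> D A"
      unfolding A_def by (intro monoD[OF mono_D]) blast
    finally show ?thesis .
  qed
  then have "A \<subseteq> D A"
    unfolding A_def by (rule UN_least)
  moreover have "A \<subseteq> start T" "A \<noteq> {}"
    using assms(1) unfolding A_def below_def by auto
  ultimately have "A \<noteq> {} \<and> A \<subseteq> start T \<and> A \<subseteq> D A"
    by blast
  then show False
    using assms(2) not_terminating_iff unfolding terminating_def by blast
qed

text \<open>Well-founded induction on \<open>R\<close>. That one stage serves both families is what
  allows the iterations of two points to be compared.\<close>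

lemma common_stage:
  assumes "wfp R" and \<sigma>: "below R \<sigma> x" and \<tau>: "above R \<tau> y"
    and x: "x \<in> topspace Y" and y: "y \<in> topspace Y"
  shows "\<exists>\<alpha>. \<sigma> n \<subseteq> S x \<alpha> \<and> S y \<alpha> \<subseteq> \<tau> n"
  using assms(1)
proof (induction n rule: wfp_induct_rule)
  case (less n)
  then obtain a where a: "\<And>m. R m n \<Longrightarrow> \<sigma> m \<subseteq> S x (a m)" "\<And>m. R m n \<Longrightarrow> S y (a m) \<subseteq> \<tau> m"
    by metis
  \<comment> \<open>Exceeding every \<open>a m\<close> gives
    \<open>S y \<alpha> \<subseteq> \<tau> n\<close>; being least, so that each \<beta> < \<alpha>
    lies at or below some \<open>a m\<close>, gives
    \<open>\<sigma> n \<subseteq> S x \<alpha>\<close>.\<close>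
  obtain \<alpha> where \<alpha>: "\<forall>b\<in>a ` {m. R m n}. b < \<alpha>" "\<forall>\<beta><\<alpha>. \<exists>b\<in>a ` {m. R m n}. \<beta> \<le> b"
    using countable_omega1_least_upper_bound[of "a ` {m. R m n}"] by auto
  have ub: "a m < \<alpha>" if "R m n" for m
    using \<alpha>(1) that by simp
  have lub: "\<exists>m. R m n \<and> \<beta> \<le> a m" if "\<beta> < \<alpha>" for \<beta>
    using \<alpha>(2) that by auto
  have "\<sigma> n \<subseteq> D (S x \<beta>)" if \<beta>: "\<beta> < \<alpha>" for \<beta>
  proof -
    obtain m where m: "R m n" "\<beta> \<le> a m"
      using lub[OF \<beta>] by blast
    then have "\<sigma> m \<subseteq> S x \<beta>"
      using a(1) S_antimono[OF x] by blast
    then show ?thesis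
      using \<sigma> m monoD[OF mono_D] unfolding below_def by blast
  qed
  moreover have "\<sigma> n \<subseteq> start x"
    using \<sigma> unfolding below_def by blast
  ultimately have "\<sigma> n \<subseteq> S x \<alpha>"
    by (subst S_eq[OF x]) blast
  moreover have "S y \<alpha> \<subseteq> D (\<tau> m)" if m: "R m n" for m
    using S_eq[OF y, of \<alpha>] ub[OF m] monoD[OF mono_D a(2)[OF m]] by blast
  then have "S y \<alpha> \<subseteq> \<tau> n"
    using \<tau> S_eq[OF y, of \<alpha>] unfolding above_def by blast
  ultimately show ?case
    by blast
qed

text \<open>The stages themselves solve the recursion: as \<open>range e\<close> is an initial
  segment, the indices \<open>m\<close> with \<open>e m < e n\<close> reach every ordinal below
  \<open>e n\<close>. The open segment serves \<open>le_cert\<close>, the closed one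
  \<open>gr_cert\<close>.\<close>

lemma stages_below_above:
  assumes range: "range e = {..<\<alpha>} \<or> range e = {..\<alpha>}" and T: "T \<in> topspace Y"
  shows "(\<forall>n. S T (e n) \<noteq> {}) \<Longrightarrow> below (\<lambda>m n. e m < e n) (\<lambda>n. S T (e n)) T"
    and "above (\<lambda>m n. e m < e n) (\<lambda>n. S T (e n)) T"
proof -
  have "{..<e n} \<subseteq> range e" for n
    using range
  proof
    assume e: "range e = {..<\<alpha>}"
    then have "e n < \<alpha>"
      by blast
    then show ?thesis
      unfolding e by auto
  next
    assume e: "range e = {..\<alpha>}"
    then have "e n \<le> \<alpha>"
      by blast
    then show ?thesis
      unfolding e by auto
  qed
  then have "(\<Inter>m\<in>{m. e m < e n}. D (S T (e m))) = (\<Inter>\<beta>\<in>{..<e n}. D (S T \<beta>))" for n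
    by blast
  then have eq: "start T \<inter> (\<Inter>m\<in>{m. e m < e n}. D (S T (e m))) = S T (e n)" for n
    using S_eq[OF T] by metis
  show "(\<forall>n. S T (e n) \<noteq> {}) \<Longrightarrow> below (\<lambda>m n. e m < e n) (\<lambda>n. S T (e n)) T"
    and "above (\<lambda>m n. e m < e n) (\<lambda>n. S T (e n)) T"
    unfolding below_def above_def eq by auto
qed

text \<open>If \<open>y\<close> is terminating, \<open>below R \<sigma> y\<close> forces \<open>R\<close> to be well-founded with all ranks below
  \<open>lifetime y\<close>; the condition on \<open>\<tau>\<close> says that \<open>x\<close> terminates at the rank of \<open>R\<close>. The first disjunct
  covers lifetime zero, for which no index is available.\<close>

definition le_cert :: "(nat \<Rightarrow> nat \<Rightarrow> bool) \<Rightarrow> (nat \<Rightarrow> nat set) \<Rightarrow> (nat \<Rightarrow> nat set) \<Rightarrow> 'y \<Rightarrow> 'y \<Rightarrow> bool"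
  where "le_cert R \<sigma> \<tau> x y \<longleftrightarrow> start x = {} \<or>
    below R \<sigma> y \<and> above R \<tau> x \<and> start x \<inter> (\<Inter>n. D (\<tau> n)) = {}"

text \<open>If \<open>R\<close> is well-founded, \<open>y\<close> terminates by the rank of an index \<open>n\<close> with \<open>\<tau> n = {}\<close> and \<open>x\<close> does
  not; otherwise \<open>x\<close> does not terminate at all.\<close>

definition gr_cert :: "(nat \<Rightarrow> nat \<Rightarrow> bool) \<Rightarrow> (nat \<Rightarrow> nat set) \<Rightarrow> (nat \<Rightarrow> nat set) \<Rightarrow> 'y \<Rightarrow> 'y \<Rightarrow> bool"
  where "gr_cert R \<sigma> \<tau> x y \<longleftrightarrow> below R \<sigma> x \<and> above R \<tau> y \<and> (\<exists>n. \<tau> n = {})"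

text \<open>Each index gets a stage at which \<open>y\<close> is still alive, hence one before
  \<open>lifetime y\<close>. So \<open>S x (lifetime y)\<close> lies in every
  \<open>D (\<tau> n)\<close> and must be empty. Conversely, an enumeration of the ordinals below
  \<open>lifetime x\<close> supplies the certificate.\<close>

lemma le_cert_iff:
  assumes x: "x \<in> topspace Y" and y: "y \<in> terminating"
  shows "(\<exists>R \<sigma> \<tau>. le_cert R \<sigma> \<tau> x y) \<longleftrightarrow> x \<in> terminating \<and> lifetime x \<le> lifetime y"
proof
  have yY: "y \<in> topspace Y"
    using y by (simp add: terminating_def)
  assume "\<exists>R \<sigma> \<tau>. le_cert R \<sigma> \<tau> x y"
  then obtain R \<sigma> \<tau> where cert: "le_cert R \<sigma> \<tau> x y"
    by blast
  have "S x (lifetime y) = {}"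
  proof (cases "start x = {}")
    case True
    then show ?thesis
      by (subst S_eq[OF x]) simp
  next
    case False
    then have \<sigma>: "below R \<sigma> y" and \<tau>: "above R \<tau> x" and fin: "start x \<inter> (\<Inter>n. D (\<tau> n)) = {}"
      using cert unfolding le_cert_def by auto
    obtain a where a: "\<And>n. \<sigma> n \<subseteq> S y (a n)" "\<And>n. S x (a n) \<subseteq> \<tau> n"
      using common_stage[OF below_imp_wfp[OF \<sigma> y] \<sigma> \<tau> yY x] by metis
    have "S y (a n) \<noteq> {}" for n
      using \<sigma> a(1) unfolding below_def by blast
    then have "a n < lifetime y" for n
      using S_eq_empty_iff[OF yY] y not_le by blast
    then have "S x (lifetime y) \<subseteq> D (\<tau> n)" for n
      using S_eq[OF x, of "lifetime y"] monoD[OF mono_D a(2)[of n]] by blast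
    then show ?thesis
      using fin S_eq[OF x, of "lifetime y"] by blast
  qed
  then show "x \<in> terminating \<and> lifetime x \<le> lifetime y"
    using S_eq_empty_iff[OF x] by blast
next
  have yY: "y \<in> topspace Y"
    using y by (simp add: terminating_def)
  assume le: "x \<in> terminating \<and> lifetime x \<le> lifetime y"
  show "\<exists>R \<sigma> \<tau>. le_cert R \<sigma> \<tau> x y"
  proof (cases "{..<lifetime x} = {}")
    case True
    then have "start x = {}"
      using S_lifetime[of x] le S_eq[OF x, of "lifetime x"] by auto
    then show ?thesis
      unfolding le_cert_def by blast
  next
    case False
    define e where "e = from_nat_into {..<lifetime x}"
    have e: "range e = {..<lifetime x}"
      unfolding e_def using False countable_lessThan_omega1 by (rule range_from_nat_into)
    then have "e n < lifetime y" for n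
      using le by (metis lessThan_iff order.strict_trans2 rangeI)
    then have "S y (e n) \<noteq> {}" for n
      using S_eq_empty_iff[OF yY] by (auto simp: not_le)
    moreover have "start x \<inter> (\<Inter>n. D (S x (e n))) = {}"
      using S_lifetime[of x] le S_eq[OF x, of "lifetime x"] unfolding e[symmetric] by auto
    ultimately have "le_cert (\<lambda>m n. e m < e n) (\<lambda>n. S y (e n)) (\<lambda>n. S x (e n)) x y"
      unfolding le_cert_def using stages_below_above[OF disjI1[OF e]] x yY by blast
    then show ?thesis
      by (intro exI)
  qed
qed

text \<open>If \<open>x\<close> terminated no later than \<open>y\<close>, then \<open>R\<close>
  would be well-founded, and at the common stage of an index with \<open>\<tau> n = {}\<close> the
  point \<open>y\<close> would have ended but \<open>x\<close> not. Conversely, the enumeration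
  includes \<open>lifetime y\<close> itself, which provides that index and keeps the segment
  nonempty.\<close>

lemma gr_cert_iff:
  assumes x: "x \<in> topspace Y" and y: "y \<in> terminating"
  shows "(\<exists>R \<sigma> \<tau>. gr_cert R \<sigma> \<tau> x y) \<longleftrightarrow> \<not> (x \<in> terminating \<and> lifetime x \<le> lifetime y)"
proof
  have yY: "y \<in> topspace Y"
    using y by (simp add: terminating_def)
  assume "\<exists>R \<sigma> \<tau>. gr_cert R \<sigma> \<tau> x y"
  then obtain R \<sigma> \<tau> n where \<sigma>: "below R \<sigma> x" and \<tau>: "above R \<tau> y" and n: "\<tau> n = {}"
    unfolding gr_cert_def by blast
  show "\<not> (x \<in> terminating \<and> lifetime x \<le> lifetime y)"
  proof
    assume le: "x \<in> terminating \<and> lifetime x \<le> lifetime y"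
    then have "wfp R"
      using below_imp_wfp[OF \<sigma>] by blast
    then obtain \<alpha> where \<alpha>: "\<sigma> n \<subseteq> S x \<alpha>" "S y \<alpha> = {}"
      using common_stage[OF _ \<sigma> \<tau> x yY, of n] n by auto
    then have "S x \<alpha> = {}"
      using le S_eq_empty_iff[OF x] S_eq_empty_iff[OF yY] by (meson order.trans)
    then show False
      using \<sigma> \<alpha>(1) unfolding below_def by blast
  qed
next
  have yY: "y \<in> topspace Y"
    using y by (simp add: terminating_def)
  assume gr: "\<not> (x \<in> terminating \<and> lifetime x \<le> lifetime y)"
  define e where "e = from_nat_into {..lifetime y}"
  have "{..lifetime y} = insert (lifetime y) {..<lifetime y}"
    by auto
  then have e: "range e = {..lifetime y}"
    unfolding e_def using countable_lessThan_omega1[of "lifetime y"] by (intro range_from_nat_into) auto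
  then have "e n \<le> lifetime y" for n
    by (metis atMost_iff rangeI)
  then have "S x (e n) \<noteq> {}" for n
    using gr S_eq_empty_iff[OF x] by (meson order.trans)
  moreover have "\<exists>n. S y (e n) = {}"
    using e S_lifetime[OF y] by (metis atMost_iff order.refl rangeE)
  ultimately have "gr_cert (\<lambda>m n. e m < e n) (\<lambda>n. S x (e n)) (\<lambda>n. S y (e n)) x y"
    unfolding gr_cert_def using stages_below_above[OF disjI2[OF e]] x yY by blast
  then show "\<exists>R \<sigma> \<tau>. gr_cert R \<sigma> \<tau> x y"
    by (intro exI)
qed

text \<open>Real coordinates, of which only the signs matter, make the codes a Polish space; the columns of
  \<open>R\<close>, that is, the sets of predecessors, are coded by \<open>c 0\<close>.\<close>

definition coded ::
    "((nat \<Rightarrow> nat \<Rightarrow> bool) \<Rightarrow> (nat \<Rightarrow> nat set) \<Rightarrow> (nat \<Rightarrow> nat set) \<Rightarrow> 'a) \<Rightarrow> (nat \<Rightarrow> nat \<Rightarrow> nat \<Rightarrow> real) \<Rightarrow> 'a"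
  where "coded \<Phi> c = \<Phi> (\<lambda>m n. m \<in> bits (c 0 n)) (\<lambda>n. bits (c 1 n)) (\<lambda>n. bits (c 2 n))"

section \<open>Borel conditions on codes and their projections\<close>

lemma ex_coded: "(\<exists>c. coded \<Phi> c) \<longleftrightarrow> (\<exists>R \<sigma> \<tau>. \<Phi> R \<sigma> \<tau>)"
proof
  assume "\<exists>R \<sigma> \<tau>. \<Phi> R \<sigma> \<tau>"
  then obtain R \<sigma> \<tau> where \<Phi>: "\<Phi> R \<sigma> \<tau>"
    by blast
  define c :: "nat \<Rightarrow> nat \<Rightarrow> nat \<Rightarrow> real" where "c = (\<lambda>i n. indicator
    (if i = 0 then {m. R m n} else if i = 1 then \<sigma> n else \<tau> n))"
  have "coded \<Phi> c"
    using \<Phi> unfolding coded_def c_def by simp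
  then show "\<exists>c. coded \<Phi> c"
    by blast
qed (auto simp: coded_def)

text \<open>\<open>M\<close>, \<open>x\<close>, \<open>y\<close> and \<open>c\<close> are arbitrary
  in the hypothesis, so that measurability of a certificate can be checked without handling the
  projections of the triple product.\<close>

lemma analytic_in_ex_cert:
  assumes "\<And>(M :: (('y \<times> 'y) \<times> (nat \<Rightarrow> nat \<Rightarrow> nat \<Rightarrow> real)) measure) x y c.
    x \<in> M \<rightarrow>\<^sub>M borel_of Y \<Longrightarrow> y \<in> M \<rightarrow>\<^sub>M borel_of Y \<Longrightarrow> c \<in> M \<rightarrow>\<^sub>M borel \<Longrightarrow>
    Measurable.pred M (\<lambda>w. coded (\<lambda>R \<sigma> \<tau>. \<Phi> R \<sigma> \<tau> (x w) (y w)) (c w))"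
  shows "analytic_in (prod_topology Y Y)
    {(x, y). x \<in> topspace Y \<and> y \<in> topspace Y \<and> (\<exists>R \<sigma> \<tau>. \<Phi> R \<sigma> \<tau> x y)}"
proof -
  let ?W = "prod_topology (prod_topology Y Y) (euclidean :: (nat \<Rightarrow> nat \<Rightarrow> nat \<Rightarrow> real) topology)"
  have "continuous_map ?W Y (\<lambda>w. fst (fst w))" "continuous_map ?W Y (\<lambda>w. snd (fst w))"
    using continuous_map_compose[OF continuous_map_fst continuous_map_fst]
      continuous_map_compose[OF continuous_map_fst continuous_map_snd]
    by (auto simp: comp_def)
  moreover have "snd \<in> borel_of ?W \<rightarrow>\<^sub>M borel"
    unfolding borel_of_euclidean[symmetric]
    by (intro continuous_map_borel_of_measurable continuous_map_snd)
  ultimately have "Measurable.pred (borel_of ?W)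
      (\<lambda>w. coded (\<lambda>R \<sigma> \<tau>. \<Phi> R \<sigma> \<tau> (fst (fst w)) (snd (fst w))) (snd w))"
    by (intro assms continuous_map_borel_of_measurable)
  then have "analytic_in (prod_topology Y Y)
      {p \<in> topspace (prod_topology Y Y). \<exists>c. coded (\<lambda>R \<sigma> \<tau>. \<Phi> R \<sigma> \<tau> (fst p) (snd p)) c}"
    by (intro analytic_in_projection Polish_space_prod_topology Polish) (simp add: split_def)
  then show ?thesis
    by (simp add: ex_coded split_def mem_Times_iff)
qed

lemma
  assumes c: "c \<in> M \<rightarrow>\<^sub>M borel"
  shows measurable_bits: "Measurable.pred M (\<lambda>w. j \<in> bits (c w i n))"
    and measurable_D_bits: "Measurable.pred M (\<lambda>w. j \<in> D (bits (c w i n)))"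
proof -
  have cin: "(\<lambda>w. c w i n) \<in> M \<rightarrow>\<^sub>M borel" for i n
    using measurable_compose[OF measurable_compose[OF c borel_measurable_apply] borel_measurable_apply] .
  have [measurable]: "(\<lambda>w. c w i n j) \<in> borel_measurable M"
    using measurable_compose[OF cin borel_measurable_apply] .
  show "Measurable.pred M (\<lambda>w. j \<in> bits (c w i n))"
    by simp
  show "Measurable.pred M (\<lambda>w. j \<in> D (bits (c w i n)))"
    using measurable_compose[OF cin measurable_D] .
qed

text \<open>Inclusions become quantifiers over naturals, the countable form that measurability
  proofs can follow.\<close>

lemma below_altdef: "below R \<sigma> T \<longleftrightarrow> (\<forall>n. (\<exists>j. j \<in> \<sigma> n) \<and>
    (\<forall>j. j \<in> \<sigma> n \<longrightarrow> j \<in> start T \<and> (\<forall>m. R m n \<longrightarrow> j \<in> D (\<sigma> m))))"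
  unfolding below_def by blast

lemma above_altdef: "above R \<tau> T \<longleftrightarrow>
    (\<forall>n j. j \<in> start T \<and> (\<forall>m. R m n \<longrightarrow> j \<in> D (\<tau> m)) \<longrightarrow> j \<in> \<tau> n)"
  unfolding above_def by blast

lemma analytic_in_le_cert: "analytic_in (prod_topology Y Y)
    {(x, y). x \<in> topspace Y \<and> y \<in> topspace Y \<and> (\<exists>R \<sigma> \<tau>. le_cert R \<sigma> \<tau> x y)}"
proof (rule analytic_in_ex_cert)
  fix M :: "(('y \<times> 'y) \<times> (nat \<Rightarrow> nat \<Rightarrow> nat \<Rightarrow> real)) measure"
    and x y and c :: "_ \<Rightarrow> nat \<Rightarrow> nat \<Rightarrow> nat \<Rightarrow> real"
  assume xy: "x \<in> M \<rightarrow>\<^sub>M borel_of Y" "y \<in> M \<rightarrow>\<^sub>M borel_of Y" 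
    and c: "c \<in> M \<rightarrow>\<^sub>M borel"
  note [measurable] = measurable_compose[OF xy(1) measurable_start]
    measurable_compose[OF xy(2) measurable_start] measurable_bits[OF c] measurable_D_bits[OF c]
  have le_cert_altdef: "le_cert R \<sigma> \<tau> x y \<longleftrightarrow> \<not> (\<exists>j. j \<in> start x) \<or>
      below R \<sigma> y \<and> above R \<tau> x \<and> \<not> (\<exists>j. j \<in> start x \<and> (\<forall>n. j \<in> D (\<tau> n)))" for R \<sigma> \<tau> x y
    unfolding le_cert_def by blast
  show "Measurable.pred M (\<lambda>w. coded (\<lambda>R \<sigma> \<tau>. le_cert R \<sigma> \<tau> (x w) (y w)) (c w))"
    unfolding coded_def le_cert_altdef below_altdef above_altdef by measurable
qed

lemma analytic_in_gr_cert: "analytic_in (prod_topology Y Y)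
    {(x, y). x \<in> topspace Y \<and> y \<in> topspace Y \<and> (\<exists>R \<sigma> \<tau>. gr_cert R \<sigma> \<tau> x y)}"
proof (rule analytic_in_ex_cert)
  fix M :: "(('y \<times> 'y) \<times> (nat \<Rightarrow> nat \<Rightarrow> nat \<Rightarrow> real)) measure"
    and x y and c :: "_ \<Rightarrow> nat \<Rightarrow> nat \<Rightarrow> nat \<Rightarrow> real"
  assume xy: "x \<in> M \<rightarrow>\<^sub>M borel_of Y" "y \<in> M \<rightarrow>\<^sub>M borel_of Y" 
    and c: "c \<in> M \<rightarrow>\<^sub>M borel"
  note [measurable] = measurable_compose[OF xy(1) measurable_start]
    measurable_compose[OF xy(2) measurable_start] measurable_bits[OF c] measurable_D_bits[OF c]
  have gr_cert_altdef: "gr_cert R \<sigma> \<tau> x y \<longleftrightarrow>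
      below R \<sigma> x \<and> above R \<tau> y \<and> (\<exists>n. \<not> (\<exists>j. j \<in> \<tau> n))" for R \<sigma> \<tau> x y
    unfolding gr_cert_def by blast
  show "Measurable.pred M (\<lambda>w. coded (\<lambda>R \<sigma> \<tau>. gr_cert R \<sigma> \<tau> (x w) (y w)) (c w))"
    unfolding coded_def gr_cert_altdef below_altdef above_altdef by measurable
qed

text \<open>The witness \<open>A\<close> of \<open>not_terminating_iff\<close> can be coded, so the
  complement is the projection of a Borel set.\<close>

lemma coanalytic_in_terminating: "coanalytic_in Y terminating"
proof -
  let ?W = "prod_topology Y (euclidean :: (nat \<Rightarrow> real) topology)"
  let ?pr = "\<lambda>T c. (\<exists>j. j \<in> bits c) \<and> (\<forall>j. j \<in> bits c \<longrightarrow> j \<in> start T \<and> j \<in> D (bits c))"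
  have fst: "fst \<in> borel_of ?W \<rightarrow>\<^sub>M borel_of Y"
    by (intro continuous_map_borel_of_measurable continuous_map_fst)
  have snd: "snd \<in> borel_of ?W \<rightarrow>\<^sub>M borel"
    unfolding borel_of_euclidean[symmetric]
    by (intro continuous_map_borel_of_measurable continuous_map_snd)
  have [measurable]: "(\<lambda>w. snd w j) \<in> borel_measurable (borel_of ?W)" for j
    using measurable_compose[OF snd borel_measurable_apply] .
  note [measurable] = measurable_compose[OF fst measurable_start] measurable_compose[OF snd measurable_D]
  have "Measurable.pred (borel_of ?W) (\<lambda>(T, c). ?pr T c)"
    unfolding split_def mem_Collect_eq by measurable
  then have "analytic_in Y {T \<in> topspace Y. \<exists>c. ?pr T c}"
    by (rule analytic_in_projection[OF Polish])
  moreover have "{T \<in> topspace Y. \<exists>c. ?pr T c} = topspace Y - terminating"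
  proof -
    have "(\<exists>c. ?pr T c) \<longleftrightarrow> T \<notin> terminating" if T: "T \<in> topspace Y" for T
      unfolding not_terminating_iff[OF T]
    proof
      assume "\<exists>c. ?pr T c"
      then obtain c where "?pr T c" ..
      then show "\<exists>A. A \<noteq> {} \<and> A \<subseteq> start T \<and> A \<subseteq> D A"
        by (intro exI[of _ "bits c"]) auto
    next
      assume "\<exists>A. A \<noteq> {} \<and> A \<subseteq> start T \<and> A \<subseteq> D A"
      then obtain A where "A \<noteq> {}" "A \<subseteq> start T" "A \<subseteq> D A"
        by blast
      then have "?pr T (indicator A)"
        unfolding bits_indicator by blast
      then show "\<exists>c. ?pr T c"
        by (rule exI[where x = "indicator A"])
    qed
    then show ?thesis
      by blast
  qed
  ultimately show ?thesis
    unfolding coanalytic_in_def terminating_def by auto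
qed

text \<open>\<open>P\<close> consists of the pairs with a \<open>le_cert\<close>; the coanalytic set
  is the complement of \<open>N\<close>, the pairs with a \<open>gr_cert\<close>. For terminating
  \<open>y\<close> both say that \<open>x\<close> terminates no later than \<open>y\<close>.\<close>

theorem coanalytic_rank_lifetime: "coanalytic_rank Y terminating lifetime"
proof -
  let ?YY = "prod_topology Y Y"
  define P where "P = {(x, y). x \<in> topspace Y \<and> y \<in> topspace Y \<and> (\<exists>R \<sigma> \<tau>. le_cert R \<sigma> \<tau> x y)}"
  define N where "N = {(x, y). x \<in> topspace Y \<and> y \<in> topspace Y \<and> (\<exists>R \<sigma> \<tau>. gr_cert R \<sigma> \<tau> x y)}"
  have "topspace ?YY - (topspace ?YY - N) = N"
    by (auto simp: N_def)
  then have "coanalytic_in ?YY (topspace ?YY - N)"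
    unfolding coanalytic_in_def using analytic_in_gr_cert by (simp add: N_def)
  moreover have "analytic_in ?YY P"
    unfolding P_def by (rule analytic_in_le_cert)
  moreover have "{x \<in> terminating. lifetime x \<le> lifetime y} = {x \<in> topspace Y. (x, y) \<in> P} \<and>
      {x \<in> terminating. lifetime x \<le> lifetime y} = {x \<in> topspace Y. (x, y) \<in> topspace ?YY - N}"
    if y: "y \<in> terminating" for y
  proof -
    have sub: "terminating \<subseteq> topspace Y"
      by (auto simp: terminating_def)
    have "(x, y) \<in> P \<longleftrightarrow> x \<in> terminating \<and> lifetime x \<le> lifetime y"
      if x: "x \<in> topspace Y" for x
      unfolding P_def mem_Collect_eq case_prod_conv le_cert_iff[OF x y] using x y sub by blast
    moreover have "(x, y) \<in> topspace ?YY - N \<longleftrightarrow> x \<in> terminating \<and> lifetime x \<le> lifetime y"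
      if x: "x \<in> topspace Y" for x
      unfolding N_def Diff_iff mem_Collect_eq case_prod_conv gr_cert_iff[OF x y] topspace_prod_topology
      using x y sub by blast
    ultimately show ?thesis
      using sub by blast
  qed
  ultimately have "analytic_in ?YY P \<and> coanalytic_in ?YY (topspace ?YY - N) \<and>
      (\<forall>y\<in>terminating. {x \<in> terminating. lifetime x \<le> lifetime y} = {x \<in> topspace Y. (x, y) \<in> P} \<and>
        {x \<in> terminating. lifetime x \<le> lifetime y} = {x \<in> topspace Y. (x, y) \<in> topspace ?YY - N})"
    by blast
  then show ?thesis
    unfolding coanalytic_rank_def
    by (intro conjI[OF Polish conjI[OF coanalytic_in_terminating]] exI)
qed

end

lemma coanalytic_rank_cong:
  assumes "coanalytic_rank Y C \<phi>" "\<And>x. x \<in> C \<Longrightarrow> \<psi> x = \<phi> x"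
  shows "coanalytic_rank Y C \<psi>"
proof -
  have "{x \<in> C. \<psi> x \<le> \<psi> y} = {x \<in> C. \<phi> x \<le> \<phi> y}" if "y \<in> C" for y
    using assms(2) that by auto
  then show ?thesis
    using assms(1) unfolding coanalytic_rank_def by simp
qed

subsection \<open>The iterates of $\Gamma$\<close>

lemma closedin_Gamma_iter:
  "closedin (prod_topology X X) E \<Longrightarrow> closedin (prod_topology X X) (Gamma_iter X E \<alpha>)"
  by (subst Gamma_iter.simps) (simp add: Gamma_def del: closure_of_Un)

lemma omega1_cases:
  obtains "\<alpha> = zero_ord" | \<beta> where "\<alpha> = suc_ord \<beta>" | "limit_ord \<alpha>"
  unfolding limit_ord_def by blast

lemma zero_ord_le: "zero_ord \<le> \<alpha>"
  unfolding zero_ord_def by (rule Least_le) simp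

text \<open>Continuous images pass to closures, so invariance of the iterates reduces to one
  algebraic step through the transitive closure. It is applied to \<open>map_prod T T\<close> and to
  \<open>prod.swap\<close>.\<close>

lemma Gamma_iter_image_subset:
  assumes E: "E \<subseteq> topspace X \<times> topspace X"
    and h: "continuous_map (prod_topology X X) (prod_topology X X) h" "h ` E \<subseteq> E"
    and step: "\<And>A. A \<subseteq> topspace X \<times> topspace X \<Longrightarrow> h ` A \<subseteq> A \<Longrightarrow>
      h ` (A\<^sup>+ \<union> Id_on (topspace X)) \<subseteq> A\<^sup>+ \<union> Id_on (topspace X)"
  shows "h ` Gamma_iter X E \<alpha> \<subseteq> Gamma_iter X E \<alpha>"
proof (induction \<alpha> rule: less_induct)
  case (less \<alpha>)
  have closure: "h ` (prod_topology X X closure_of A) \<subseteq> prod_topology X X closure_of A" if "h ` A \<subseteq> A" for A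
    using continuous_map_image_closure_subset[OF h(1)] closure_of_mono[OF that] by (rule order.trans)
  show ?case
  proof (cases \<alpha> rule: omega1_cases)
    case 1
    then show ?thesis
      using h(2) by (simp add: Gamma_iter_zero)
  next
    case (2 \<beta>)
    then show ?thesis
      unfolding 2 Gamma_iter_suc Gamma_def
      by (intro closure step Gamma_iter_subset[OF E] less.IH) (simp add: 2 less_suc_ord)
  next
    case 3
    then show ?thesis
      unfolding Gamma_iter_limit[OF 3] using less.IH by (intro closure) blast
  qed
qed

lemma map_prod_trancl_subset:
  assumes "map_prod f f ` A \<subseteq> A"
  shows "map_prod f f ` A\<^sup>+ \<subseteq> A\<^sup>+"
proof -
  have "(f x, f y) \<in> A\<^sup>+" if "(x, y) \<in> A\<^sup>+" for x y
    using that
  proof induction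
    case (base y)
    then show ?case
      using assms by (auto intro: r_into_trancl)
  next
    case (step y z)
    then have "(f y, f z) \<in> A"
      using assms by auto
    with step show ?case
      by (auto intro: trancl_into_trancl)
  qed
  then show ?thesis
    by auto
qed

lemma invariant_pairs_Gamma_iter:
  assumes E: "E \<subseteq> topspace X \<times> topspace X" and T: "continuous_map X X T" "invariant_pairs T E"
  shows "invariant_pairs T (Gamma_iter X E \<alpha>)"
  unfolding invariant_pairs_def
proof (rule Gamma_iter_image_subset[OF E])
  show "continuous_map (prod_topology X X) (prod_topology X X) (map_prod T T)"
    using continuous_map_compose[OF continuous_map_fst T(1), of X]
      continuous_map_compose[OF continuous_map_snd T(1), of X]
    by (simp add: map_prod_def split_def comp_def continuous_map_paired)
  show "map_prod T T ` E \<subseteq> E"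
    using T(2) by (simp add: invariant_pairs_def)
  have "map_prod T T ` Id_on (topspace X) \<subseteq> Id_on (topspace X)"
    using T(1) by (auto simp: continuous_map_def)
  then show "map_prod T T ` (A\<^sup>+ \<union> Id_on (topspace X)) \<subseteq> A\<^sup>+ \<union> Id_on (topspace X)"
    if "map_prod T T ` A \<subseteq> A" for A
    using map_prod_trancl_subset[OF that] by (auto simp: image_Un)
qed

lemma sym_iff_swap_image: "sym A \<longleftrightarrow> prod.swap ` A \<subseteq> A"
  by (auto simp: sym_def)

lemma sym_Gamma_iter:
  assumes E: "E \<subseteq> topspace X \<times> topspace X" and "sym E"
  shows "sym (Gamma_iter X E \<alpha>)"
  unfolding sym_iff_swap_image
proof (rule Gamma_iter_image_subset[OF E])
  show "continuous_map (prod_topology X X) (prod_topology X X) prod.swap"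
    using continuous_map_pairedI[OF continuous_map_snd continuous_map_fst, of X X]
    by (simp add: prod.swap_def[abs_def])
  show "prod.swap ` E \<subseteq> E"
    using \<open>sym E\<close> by (simp add: sym_iff_swap_image)
  show "prod.swap ` (A\<^sup>+ \<union> Id_on (topspace X)) \<subseteq> A\<^sup>+ \<union> Id_on (topspace X)"
    if "prod.swap ` A \<subseteq> A" for A
    using that unfolding sym_iff_swap_image[symmetric] by (intro sym_Un sym_trancl sym_Id_on)
qed

text \<open>Transitivity absorbs the chains, reflexivity the diagonal, and closedness the
  closure.\<close>

lemma Gamma_iter_subset_closed_equiv:
  assumes R: "equiv (topspace X) R" "closedin (prod_topology X X) R" and "E \<subseteq> R"
  shows "Gamma_iter X E \<alpha> \<subseteq> R"
proof (induction \<alpha> rule: less_induct)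
  case (less \<alpha>)
  show ?case
  proof (cases \<alpha> rule: omega1_cases)
    case 1
    then show ?thesis
      using assms(3) by (simp add: Gamma_iter_zero)
  next
    case (2 \<beta>)
    then have "(Gamma_iter X E \<beta>)\<^sup>+ \<subseteq> R\<^sup>+"
      using less.IH less_suc_ord by (intro subsetI) (auto intro: trancl_mono)
    also have "R\<^sup>+ = R"
      using R(1) by (simp add: equiv_def)
    finally have "(Gamma_iter X E \<beta>)\<^sup>+ \<union> Id_on (topspace X) \<subseteq> R"
      using R(1) by (auto simp: equiv_def refl_on_def)
    then show ?thesis
      unfolding 2 Gamma_iter_suc Gamma_def using R(2) by (rule closure_of_minimal)
  next
    case 3
    then show ?thesis
      unfolding Gamma_iter_limit[OF 3] using less.IH R(2) by (intro closure_of_minimal) auto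
  qed
qed

text \<open>Symmetry of \<open>E\<close> passes to the iterates, so a stationary iterate is itself
  one of the relations intersected in \<open>ICER_generated\<close>. Conversely, each of those
  relations contains every iterate.\<close>

lemma ICER_generated_eq_all_iff:
  assumes X: "compact_space X" "metrizable_space X" and T: "continuous_map X X T"
    and E: "closedin (prod_topology X X) E" "sym E" "invariant_pairs T E"
  shows "ICER_generated X T E = topspace X \<times> topspace X \<longleftrightarrow>
    (\<exists>\<alpha>. Gamma_iter X E \<alpha> = topspace X \<times> topspace X)"
proof -
  let ?all = "topspace X \<times> topspace X"
  have sub: "E \<subseteq> ?all"
    using closedin_subset[OF E(1)] by simp
  have "closedin (prod_topology X X) ?all"
    using closedin_topspace[of "prod_topology X X"] by simp
  moreover have "equiv (topspace X) ?all"
    by (auto simp: equiv_def refl_on_def sym_def trans_def)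
  moreover have "invariant_pairs T ?all"
    using T by (auto simp: invariant_pairs_def continuous_map_def)
  ultimately have le: "ICER_generated X T E \<subseteq> ?all"
    unfolding ICER_generated_def using sub by blast
  show ?thesis
  proof
    assume all: "ICER_generated X T E = ?all"
    obtain \<alpha> where \<alpha>: "Gamma_iter X E \<alpha> = Gamma_iter X E (suc_ord \<alpha>)"
      using Gamma_rank_exists[OF X E(1)] by blast
    let ?R = "Gamma_iter X E \<alpha>"
    have R: "?R \<subseteq> ?all" "closedin (prod_topology X X) ?R"
      using Gamma_iter_subset[OF sub] closedin_Gamma_iter[OF E(1)] by auto
    have "?R\<^sup>+ \<union> Id_on (topspace X) \<subseteq> topspace (prod_topology X X)"
      using R(1) trancl_subset_Sigma[OF R(1)] by auto
    then have "?R\<^sup>+ \<union> Id_on (topspace X) \<subseteq> Gamma X ?R"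
      unfolding Gamma_def by (rule closure_of_subset)
    \<comment> \<open>Stationarity says \<open>Gamma X ?R = ?R\<close>, so chains and diagonal
      already lie in \<open>?R\<close>.\<close>
    then have step: "?R\<^sup>+ \<union> Id_on (topspace X) \<subseteq> ?R"
      by (rule subset_trans[OF _ equalityD2[OF \<alpha>[unfolded Gamma_iter_suc]]])
    have "trans ?R"
    proof (rule transI)
      fix x y z assume "(x, y) \<in> ?R" "(y, z) \<in> ?R"
      then have "(x, z) \<in> ?R\<^sup>+"
        by auto
      then show "(x, z) \<in> ?R"
        using step by blast
    qed
    then have "equiv (topspace X) ?R"
      using R(1) step sym_Gamma_iter[OF sub E(2)] by (auto simp: equiv_def refl_on_def)
    moreover have "invariant_pairs T ?R"
      using sub T E(3) by (rule invariant_pairs_Gamma_iter)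
    moreover have "E \<subseteq> ?R"
      using Gamma_iter_mono[OF sub zero_ord_le] by (simp add: Gamma_iter_zero)
    ultimately have "ICER_generated X T E \<subseteq> ?R"
      unfolding ICER_generated_def using R(2) by blast
    then show "\<exists>\<alpha>. Gamma_iter X E \<alpha> = ?all"
      using all R(1) by blast
  next
    assume "\<exists>\<alpha>. Gamma_iter X E \<alpha> = ?all"
    then have "?all \<subseteq> R" if "equiv (topspace X) R" "closedin (prod_topology X X) R" "E \<subseteq> R" for R
      using Gamma_iter_subset_closed_equiv[OF that] by metis
    then show "ICER_generated X T E = ?all"
      using le unfolding ICER_generated_def by blast
  qed
qed

subsection \<open>Closed relations coded by sets of natural numbers\<close>

locale square_base =
  fixes X :: "'a topology" and V :: "nat \<Rightarrow> ('a \<times> 'a) set"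
  assumes compact: "compact_space X" and metrizable: "metrizable_space X"
    and openin_V: "\<And>j. openin (prod_topology X X) (V j)"
    and base: "\<And>U p. openin (prod_topology X X) U \<Longrightarrow> p \<in> U \<Longrightarrow> \<exists>j. p \<in> V j \<and> V j \<subseteq> U"
begin

definition uncovered :: "nat set \<Rightarrow> ('a \<times> 'a) set"
  where "uncovered S = topspace X \<times> topspace X - (\<Union>j\<in>S. V j)"

text \<open>On closed relations \<open>uncovered\<close> inverts this coding. The clause
  \<open>V j \<noteq> {}\<close> gives the full square the empty code, so that reaching it means
  termination.\<close>

definition missed :: "('a \<times> 'a) set \<Rightarrow> nat set"
  where "missed A = {j. V j \<noteq> {} \<and> V j \<inter> A = {}}"

text \<open>This is \<open>Gamma\<close> acting on codes. No closure is taken, since an open set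
  misses a set iff it misses its closure.\<close>

definition missed_step :: "nat set \<Rightarrow> nat set"
  where "missed_step S = missed ((uncovered S)\<^sup>+ \<union> Id_on (topspace X))"

lemma V_subset: "V j \<subseteq> topspace X \<times> topspace X"
  using openin_subset[OF openin_V] by simp

lemma uncovered_missed:
  assumes "closedin (prod_topology X X) A"
  shows "uncovered (missed A) = A"
proof -
  have "A \<subseteq> topspace X \<times> topspace X"
    using closedin_subset[OF assms] by simp
  moreover have "\<exists>j. j \<in> missed A \<and> p \<in> V j" if "p \<in> topspace X \<times> topspace X" "p \<notin> A" for p
  proof -
    have "openin (prod_topology X X) (topspace (prod_topology X X) - A)"
      using assms by (simp add: closedin_def)
    moreover have "p \<in> topspace (prod_topology X X) - A"
      using that by simp
    ultimately obtain j where "p \<in> V j" "V j \<subseteq> topspace (prod_topology X X) - A"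
      using base by blast
    then show ?thesis
      unfolding missed_def by blast
  qed
  moreover have "V j \<inter> A = {}" if "j \<in> missed A" for j
    using that by (simp add: missed_def)
  ultimately show ?thesis
    unfolding uncovered_def by blast
qed

lemma missed_closure: "missed (prod_topology X X closure_of A) = missed A"
  unfolding missed_def using openin_Int_closure_of_eq_empty[OF openin_V] by blast

lemma missed_antimono: "A \<subseteq> B \<Longrightarrow> missed B \<subseteq> missed A"
  unfolding missed_def by blast

lemma missed_step_missed:
  "closedin (prod_topology X X) A \<Longrightarrow> missed_step (missed A) = missed (Gamma X A)"
  unfolding missed_step_def Gamma_def missed_closure by (simp add: uncovered_missed)

lemma missed_eq_empty_iff:
  assumes "closedin (prod_topology X X) A"
  shows "missed A = {} \<longleftrightarrow> A = topspace X \<times> topspace X"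
proof
  assume "missed A = {}"
  then show "A = topspace X \<times> topspace X"
    using uncovered_missed[OF assms] by (simp add: uncovered_def)
next
  assume "A = topspace X \<times> topspace X"
  then show "missed A = {}"
    using V_subset unfolding missed_def by blast
qed

lemma mono_missed_step: "mono missed_step"
proof (rule monoI)
  fix S S' :: "nat set" assume "S \<subseteq> S'"
  then have "uncovered S' \<subseteq> uncovered S"
    unfolding uncovered_def by blast
  then have "(uncovered S')\<^sup>+ \<subseteq> (uncovered S)\<^sup>+"
    by (auto intro: trancl_mono)
  then show "missed_step S \<subseteq> missed_step S'"
    unfolding missed_step_def by (intro missed_antimono) blast
qed

text \<open>Each \<beta> < \<alpha> contributes the code of the successor iterate. At a successor
  the last term decides; at a limit the closure is invisible to the open sets \<open>V j\<close>; at
  zero only \<open>missed E\<close> remains.\<close>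

lemma missed_Gamma_iter:
  assumes E: "closedin (prod_topology X X) E"
  shows "missed (Gamma_iter X E \<alpha>) =
    missed E \<inter> (\<Inter>\<beta>\<in>{..<\<alpha>}. missed_step (missed (Gamma_iter X E \<beta>)))"
proof -
  have sub: "E \<subseteq> topspace X \<times> topspace X"
    using closedin_subset[OF E] by simp
  have step: "missed_step (missed (Gamma_iter X E \<beta>)) = missed (Gamma_iter X E (suc_ord \<beta>))" for \<beta>
    unfolding Gamma_iter_suc by (rule missed_step_missed[OF closedin_Gamma_iter[OF E]])
  have anti: "missed (Gamma_iter X E \<gamma>) \<subseteq> missed (Gamma_iter X E \<beta>)" if "\<beta> \<le> \<gamma>" for \<beta> \<gamma>
    using Gamma_iter_mono[OF sub that] by (rule missed_antimono)
  show ?thesis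
    unfolding step
  proof
    show "missed (Gamma_iter X E \<alpha>) \<subseteq>
        missed E \<inter> (\<Inter>\<beta>\<in>{..<\<alpha>}. missed (Gamma_iter X E (suc_ord \<beta>)))"
      using anti[OF zero_ord_le, of \<alpha>] anti[OF suc_ord_le] unfolding Gamma_iter_zero by blast
    show "missed E \<inter> (\<Inter>\<beta>\<in>{..<\<alpha>}. missed (Gamma_iter X E (suc_ord \<beta>))) \<subseteq>
        missed (Gamma_iter X E \<alpha>)"
    proof (cases \<alpha> rule: omega1_cases)
      case 1
      then show ?thesis
        by (simp add: Gamma_iter_zero)
    next
      case (2 \<beta>)
      then show ?thesis
        using less_suc_ord by blast
    next
      case 3
      have "missed (Gamma_iter X E (suc_ord \<beta>)) \<subseteq> missed (Gamma_iter X E \<beta>)" for \<beta>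
        using less_suc_ord less_imp_le by (intro anti) blast
      then show ?thesis
        unfolding Gamma_iter_limit[OF 3] missed_closure by (fastforce simp: missed_def)
    qed
  qed
qed

text \<open>Chains are infinite sequences of which only the first \<open>k + 1\<close> terms matter,
  so one compact product serves all \<open>k\<close>.\<close>

definition chain_codes :: "nat \<Rightarrow> ('a \<times> 'a) set \<Rightarrow> (nat \<Rightarrow> real) set"
  where "chain_codes k F = {c. \<exists>u\<in>topspace (product_topology (\<lambda>_::nat. X) UNIV).
    (\<forall>i<k. (u i, u (Suc i)) \<in> uncovered (bits c)) \<and> (u 0, u k) \<in> F}"

text \<open>The set of codes is the projection of a closed set along the compact space of sequences in \<open>X\<close>.\<close>

lemma closed_chain_codes:
  assumes F: "closedin (prod_topology X X) F"
  shows "closed (chain_codes k F)"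
proof -
  let ?U = "product_topology (\<lambda>_::nat. X) UNIV"
  let ?W = "prod_topology (euclidean :: (nat \<Rightarrow> real) topology) ?U"
  \<comment> \<open>The broken chains: some step \<open>i < k\<close> falls into a
    \<open>V j\<close> whose bit is on. Both conditions are open.\<close>
  define G where "G = (\<Union>i\<in>{..<k}. \<Union>j. {w \<in> topspace ?W. fst w j > 0} \<inter>
    {w \<in> topspace ?W. (snd w i, snd w (Suc i)) \<in> V j})"
  define K where "K = {w \<in> topspace ?W. (snd w 0, snd w k) \<in> F} - G"
  have coord: "continuous_map ?W X (\<lambda>w. snd w i)" for i
    using continuous_map_compose[OF continuous_map_snd continuous_map_product_projection, of i UNIV euclidean "\<lambda>_. X"]
    by (simp add: comp_def)
  have pair: "continuous_map ?W (prod_topology X X) (\<lambda>w. (snd w i, snd w i'))" for i i'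
    by (intro continuous_map_pairedI coord)
  have "continuous_map euclidean euclidean (\<lambda>c :: nat \<Rightarrow> real. c j)" for j
    by (simp add: continuous_on_product_coordinates)
  then have "continuous_map ?W euclidean (\<lambda>w. fst w j)" for j
    using continuous_map_compose[OF continuous_map_fst, of euclidean euclidean "\<lambda>c. c j" ?U]
    by (simp add: comp_def)
  then have "openin ?W {w \<in> topspace ?W. fst w j \<in> {0<..}}" for j
    by (rule openin_continuous_map_preimage) (simp add: open_greaterThan)
  then have "openin ?W G"
    unfolding G_def using openin_continuous_map_preimage[OF pair openin_V]
    by (intro openin_Union ballI openin_Int) (auto intro!: openin_Union openin_Int)
  then have "closedin ?W K"
    unfolding K_def using closedin_continuous_map_preimage[OF pair F] by (intro closedin_diff)
  moreover have "closed_map ?W euclidean fst"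
    using compact by (intro closed_map_fst) (simp add: compact_space_product_topology)
  ultimately have "closed (fst ` K)"
    unfolding closed_map_def by simp
  moreover have "fst ` K = chain_codes k F"
  proof -
    have K_iff: "(c, u) \<in> K \<longleftrightarrow> u \<in> topspace ?U \<and>
        (\<forall>i<k. (u i, u (Suc i)) \<in> uncovered (bits c)) \<and> (u 0, u k) \<in> F" for c u
      unfolding K_def G_def uncovered_def by (auto simp: PiE_iff)
    have "fst ` K = {c. \<exists>u. (c, u) \<in> K}"
      by force
    then show ?thesis
      unfolding chain_codes_def K_iff by blast
  qed
  ultimately show ?thesis
    by simp
qed

text \<open>Length \<open>k = 0\<close> is excluded because the transitive closure asks for at least
  one step.\<close>

lemma Int_trancl_uncovered_eq_empty_iff:
  "\<Union>\<F> \<inter> (uncovered (bits c))\<^sup>+ = {} \<longleftrightarrow> c \<notin> (\<Union>F\<in>\<F>. \<Union>k\<in>{0<..}. chain_codes k F)"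
proof -
  have "(\<exists>k>0. c \<in> chain_codes k F) \<longleftrightarrow> F \<inter> (uncovered (bits c))\<^sup>+ \<noteq> {}" for F
  proof
    assume "\<exists>k>0. c \<in> chain_codes k F"
    then obtain k u where k: "k > 0" and u: "\<forall>i<k. (u i, u (Suc i)) \<in> uncovered (bits c)" "(u 0, u k) \<in> F"
      unfolding chain_codes_def by blast
    then have "(u 0, u k) \<in> (uncovered (bits c)) ^^ k"
      unfolding relpow_fun_conv by blast
    then have "(u 0, u k) \<in> (uncovered (bits c))\<^sup>+"
      using k unfolding trancl_power by blast
    then show "F \<inter> (uncovered (bits c))\<^sup>+ \<noteq> {}"
      using u(2) by blast
  next
    assume "F \<inter> (uncovered (bits c))\<^sup>+ \<noteq> {}"
    then obtain a b where "(a, b) \<in> F" "(a, b) \<in> (uncovered (bits c))\<^sup>+"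
      by (metis disjoint_iff surj_pair)
    then obtain k where ab: "(a, b) \<in> F" "k > 0" "(a, b) \<in> (uncovered (bits c)) ^^ k"
      unfolding trancl_power by blast
    then obtain f where f: "f 0 = a" "f k = b" "\<And>i. i < k \<Longrightarrow> (f i, f (Suc i)) \<in> uncovered (bits c)"
      unfolding relpow_fun_conv by blast
    have "f i \<in> topspace X" if "i \<le> k" for i
    proof (cases "i = k")
      case True
      then show ?thesis
        using f(3)[of "k - 1"] ab(2) by (auto simp: uncovered_def)
    next
      case False
      then show ?thesis
        using f(3)[of i] that by (auto simp: uncovered_def)
    qed
    \<comment> \<open>Beyond \<open>k\<close> the values of \<open>f\<close> are uncontrolled;
      freezing the chain at its last point keeps it in the product.\<close>
    then have "(\<lambda>i. f (min i k)) \<in> topspace (product_topology (\<lambda>_::nat. X) UNIV)"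
      by (auto simp: PiE_iff)
    moreover have "\<forall>i<k. (f (min i k), f (min (Suc i) k)) \<in> uncovered (bits c)"
      using f(3) by (simp add: min_def)
    ultimately have "c \<in> chain_codes k F"
      unfolding chain_codes_def using ab(1) f(1,2)
      by (intro CollectI bexI[of _ "\<lambda>i. f (min i k)"]) auto
    then show "\<exists>k>0. c \<in> chain_codes k F"
      using ab(2) by blast
  qed
  then show ?thesis
    by blast
qed

text \<open>\<open>closed_chain_codes\<close> concerns closed \<open>F\<close>, while
  \<open>V j\<close> is open. By metrizability \<open>V j\<close> is a countable union of closed
  sets, so the codes with a chain ending in \<open>V j\<close> form a countable union of closed
  sets.\<close>

lemma measurable_missed_step: "Measurable.pred borel (\<lambda>c. j \<in> missed_step (bits c))"
proof -
  have "fsigma_in (prod_topology X X) (V j)"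
    using metrizable openin_V by (intro open_imp_fsigma_in) (simp_all add: metrizable_space_prod_topology)
  then have "\<exists>\<F>. countable \<F> \<and> \<F> \<subseteq> Collect (closedin (prod_topology X X)) \<and> \<Union>\<F> = V j"
    unfolding fsigma_in_def union_of_def .
  then obtain \<F> where \<F>: "countable \<F>" "\<F> \<subseteq> Collect (closedin (prod_topology X X))" "\<Union>\<F> = V j"
    by (elim exE conjE)
  define H where "H = (\<Union>F\<in>\<F>. \<Union>k\<in>{0<..}. chain_codes k F)"
  have [measurable]: "H \<in> sets borel"
    unfolding H_def using \<F>(1,2) closed_chain_codes
    by (intro sets.countable_UN'' borel_closed) auto
  have "j \<in> missed_step (bits c) \<longleftrightarrow> V j \<noteq> {} \<and> V j \<inter> Id_on (topspace X) = {} \<and> c \<notin> H" for c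
    unfolding missed_step_def missed_def H_def Int_trancl_uncovered_eq_empty_iff[symmetric] \<F>(3) by blast
  then show ?thesis
    by simp
qed

text \<open>Hitting \<open>V j\<close> is a subbasic open condition in the Vietoris
  topology.\<close>

lemma measurable_missed:
  assumes f: "f \<in> M \<rightarrow>\<^sub>M borel_of (Vietoris (prod_topology X X))"
  shows "Measurable.pred M (\<lambda>T. j \<in> missed (f T))"
proof -
  define H where "H = {K. compactin (prod_topology X X) K \<and> K \<inter> V j \<noteq> {}}"
  have "openin (Vietoris (prod_topology X X)) H"
    unfolding Vietoris_def H_def
    by (intro topology_generated_by_Basis UnI2 CollectI exI[of _ "V j"] conjI refl openin_V)
  then have [measurable]: "H \<in> sets (borel_of (Vietoris (prod_topology X X)))"
    by (rule openin_imp_borel_of)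
  note f [measurable]
  have "Measurable.pred M (\<lambda>T. V j \<noteq> {} \<and> \<not> f T \<in> H)"
    by measurable
  moreover have "V j \<noteq> {} \<and> \<not> f T \<in> H \<longleftrightarrow> j \<in> missed (f T)" if "T \<in> space M" for T
    using measurable_space[OF f that] unfolding H_def missed_def by (auto simp: topspace_Vietoris)
  ultimately show ?thesis
    by (simp cong: measurable_cong)
qed

end

section \<open>The assignment as a Borel iteration\<close>

lemma square_base_exists:
  assumes "compact_space X" "metrizable_space X"
  obtains V where "square_base X V"
proof -
  have "second_countable (prod_topology X X)"
    using assms by (intro compact_metrizable_imp_second_countable)
      (simp_all add: compact_space_prod_topology metrizable_space_prod_topology)
  then obtain B where B: "countable B" "\<And>U. U \<in> B \<Longrightarrow> openin (prod_topology X X) U"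
    "\<And>U p. openin (prod_topology X X) U \<Longrightarrow> p \<in> U \<Longrightarrow> \<exists>W\<in>B. p \<in> W \<and> W \<subseteq> U"
    unfolding second_countable_def by metis
  \<comment> \<open>The empty set is added because \<open>from_nat_into\<close> enumerates exactly
    its argument only if that is nonempty.\<close>
  define V where "V = from_nat_into (insert {} B)"
  have range: "range V = insert {} B"
    unfolding V_def using B(1) by (intro range_from_nat_into) auto
  have "square_base X V"
  proof
    show "openin (prod_topology X X) (V j)" for j
      using range B(2) by (metis insertE openin_empty rangeI)
    show "\<exists>j. p \<in> V j \<and> V j \<subseteq> U" if U: "openin (prod_topology X X) U" "p \<in> U" for U p
    proof -
      obtain W where "W \<in> range V" "p \<in> W" "W \<subseteq> U"
        using B(3)[OF U] unfolding range by blast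
      then show ?thesis
        by blast
    qed
  qed (use assms in auto)
  then show thesis
    by (rule that)
qed

text \<open>Symmetry of \<open>P X T\<close> makes the stationary iterate an equivalence relation,
  which identifies realizability with termination of the coded iteration;
  \<open>coanalytic_rank_lifetime\<close> then applies.\<close>

theorem theorem5p11:
  fixes P :: "'a topology \<Rightarrow> ('a \<Rightarrow> 'a) \<Rightarrow> ('a \<times> 'a) set" and X :: "'a topology"
  assumes assignment: "dynamical_pair_assignment P"
    and compact: "compact_space X" and metrizable: "metrizable_space X"
    and symmetric: "\<And>T. T \<in> C_self X \<Longrightarrow> sym (P X T)"
  shows "coanalytic_rank (uniform_topology X) (realizable_maps P X) (pair_rank P X)"
proof -
  let ?XX = "prod_topology X X"
  obtain V where "square_base X V"
    using compact metrizable by (rule square_base_exists)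
  then interpret square_base X V .
  have P_compact: "compactin ?XX (P X T)" and P_inv: "invariant_pairs T (P X T)" if "T \<in> C_self X" for T
    using assignment compact metrizable that unfolding dynamical_pair_assignment_def by blast+
  have P_meas: "P X \<in> borel_of (uniform_topology X) \<rightarrow>\<^sub>M borel_of (Vietoris ?XX)"
    using assignment compact metrizable unfolding dynamical_pair_assignment_def by blast
  have "Hausdorff_space ?XX"
    using metrizable by (simp add: metrizable_imp_Hausdorff_space metrizable_space_prod_topology)
  then have P_closed: "closedin ?XX (P X T)" if "T \<in> C_self X" for T
    using P_compact[OF that] by (rule compactin_imp_closedin)
  interpret borel_iteration "uniform_topology X" "\<lambda>T. missed (P X T)" missed_step
    "\<lambda>T \<alpha>. missed (Gamma_iter X (P X T) \<alpha>)"
    by unfold_locales (fact Polish_space_uniform_topology[OF compact metrizable] mono_missed_step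
      measurable_missed_step measurable_missed[OF P_meas] missed_Gamma_iter[OF P_closed])+
  have closed_iter: "closedin ?XX (Gamma_iter X (P X T) \<alpha>)" if "T \<in> C_self X" for T \<alpha>
    using P_closed[OF that] by (rule closedin_Gamma_iter)
  have "realizable P X T \<longleftrightarrow> (\<exists>\<alpha>. missed (Gamma_iter X (P X T) \<alpha>) = {})" if T: "T \<in> C_self X" for T
  proof -
    have "continuous_map X X T"
      using T C_self_eq[OF compact metrizable] by blast
    then show ?thesis
      unfolding realizable_def missed_eq_empty_iff[OF closed_iter[OF T]]
      using compact metrizable P_closed[OF T] symmetric[OF T] P_inv[OF T]
      by (intro ICER_generated_eq_all_iff)
  qed
  then have eq: "realizable_maps P X = terminating"
    unfolding realizable_maps_def terminating_def by blast
  have "pair_rank P X T = lifetime T" if "T \<in> terminating" for T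
  proof -
    have T: "T \<in> C_self X"
      using that unfolding terminating_def by blast
    \<comment> \<open>For terminating \<open>T\<close> the iteration is stationary only at the full
      square, as a nonempty stationary code would be a set \<open>A\<close> as in
      \<open>not_terminating_iff\<close>. Rank and lifetime are thus least elements of the same
      set.\<close>
    have "Gamma_iter X (P X T) \<alpha> = Gamma_iter X (P X T) (suc_ord \<alpha>) \<longleftrightarrow>
        missed (Gamma_iter X (P X T) \<alpha>) = {}" for \<alpha>
    proof
      let ?A = "missed (Gamma_iter X (P X T) \<alpha>)"
      assume "Gamma_iter X (P X T) \<alpha> = Gamma_iter X (P X T) (suc_ord \<alpha>)"
      then have "?A \<subseteq> missed (P X T)" "?A \<subseteq> missed_step ?A"
        using S_eq[OF T, of "suc_ord \<alpha>"] less_suc_ord[of \<alpha>] by auto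
      then show "?A = {}"
        using that not_terminating_iff[OF T] by blast
    next
      assume "missed (Gamma_iter X (P X T) \<alpha>) = {}"
      moreover from this have "missed (Gamma_iter X (P X T) (suc_ord \<alpha>)) = {}"
        using S_antimono[OF T less_imp_le[OF less_suc_ord]] by blast
      ultimately show "Gamma_iter X (P X T) \<alpha> = Gamma_iter X (P X T) (suc_ord \<alpha>)"
        unfolding missed_eq_empty_iff[OF closed_iter[OF T]] by simp
    qed
    then show ?thesis
      unfolding pair_rank_def Gamma_rank_def lifetime_def by simp
  qed
  then show ?thesis
    unfolding eq by (rule coanalytic_rank_cong[OF coanalytic_rank_lifetime])
qed

end
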